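(* Let $A$ be a countable abelian group and let $\phi\in\mathrm{Aut}(A)$. Then, under the identification $K_0(C^*(\Gamma(A)))\cong A$, $[p_{v_a}]\mapsto a$, one has $\underline{\Gamma(\phi)}=\phi$.
   Context: **Graphs.** A directed graph $G=(V,E,r,s)$ consists of countable sets $V$ (vertices), $E$ (edges) and maps $r,s:E\to V$ (range, source). It is row-finite if $r^{-1}(v)$ is finite for all $v\in V$. An automorphism of $G$ is a bijection $\phi:V\to V$ that preserves edges in both directions, counted with multiplicity: for all $v,w\in V$ there are as many edges from $v$ to $w$ as from $\phi(v)$ to $\phi(w)$. Thus $\phi$ also comes with a bijection $e\mapsto\phi(e)$ of $E$ satisfying $s(\phi(e))=\phi(s(e))$, $r(\phi(e))=\phi(r(e))$. **Graph $C^*$-algebra.** For a row-finite directed graph $G$, $C^*(G)$ is the universal $C^*$-algebra generated by mutually orthogonal projections $\{p_v\}_{v\in V}$ and partial isometries $\{S_e\}_{e\in E}$ subject to $S_e^*S_e=p_{s(e)}$ for $e\in E$ and $\sum_{r(e)=v}S_eS_e^*=p_v$ for every $v\in V$ with $r^{-1}(v)\neq\emptyset$. Let $V_E=\{v\in V: r^{-1}(v)\ne\emptyset\}$ and let $B:\mathbb{Z}V_E\to\mathbb{Z}V$ be the homomorphism of free abelian groups with $B(v)=v-\sum_{r(e)=v}s(e)$. It is a known fact that $K_0(C^*(G))\cong\mathrm{coker}(B)$ via $[p_v]\mapsto v$. **The automorphism $\underline{\psi}$.** For a graph automorphism $\psi$ of $G$, the $\mathbb{Z}$-linear extension of $\psi$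 to $\mathbb{Z}V$ descends to an automorphism of $\mathrm{coker}(B)\cong K_0(C^*(G))$, denoted $\underline{\psi}$; so $\underline{\psi}([p_v])=[p_{\psi(v)}]$. **The graph $\Gamma(A)$.** Let $A$ be a countable abelian group. Vertices of $\Gamma(A)$: - $v_a$ and $u_a$ for each $a\in A$; - for each ordered pair $(a,b)\in A\times A$: two distinct vertices $w^{(1)}_{ab},w^{(2)}_{ab}$ (also when $a=b$), a vertex $u_{ab}$, and vertices $u^n_{ab}$ for $n\ge1$. All these vertices are distinct. Edges of $\Gamma(A)$ (written source $\to$ range): - for each $c\in A$: one edge $v_c\to u_c$ and two loops at $u_c$; - for each $(a,b)\in A\times A$, with $c=a+b$: one edge each $v_a\to w^{(1)}_{ab}$, $v_b\to w^{(2)}_{ab}$, $w^{(1)}_{ab}\to u_{ab}$, $w^{(2)}_{ab}\to u_{ab}$, $u_c\to u_{ab}$; - for each $(a,b)$: one edge $u_{ab}\to u^1_{ab}$, one edge $u^{n-1}_{ab}\to u^n_{ab}$ for each $n\ge2$, and one loop at $u^n_{ab}$ for each $n\geq1$. $\Gamma(A)$ is row-finite, and $[p_{v_a}]\mapsto a$ defines a group isomorphism $K_0(C^*(\Gamma(A)))\cong A$, which is the identification used in the claim. **The automorphism $\Gamma(\phi)$.** For $\phi\in\mathrm{Aut}(A)$, $\Gamma(\phi)\in\mathrm{Aut}(\Gamma(A))$ is given on vertices by $v_a\mapsto v_{\phi(a)}$, $u_a\mapsto u_{\phi(a)}$, $w^{(i)}_{ab}\mapsto w^{(i)}_{\phi(a)\phi(b)}$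 $(i=1,2)$, $u_{ab}\mapsto u_{\phi(a)\phi(b)}$, $u^n_{ab}\mapsto u^n_{\phi(a)\phi(b)}$. *)

theory Defs
  imports "HOL-Algebra.Free_Abelian_Groups" "HOL-Algebra.Module" "HOL-Algebra.Coset"
    Complex_Main "Graph_Theory.Digraph"
begin

section \<open>$C^*$-algebras\<close>

text \<open>
  The algebras are not assumed to be unital: the field \<^const>\<open>one\<close> inherited from the library's
  records is not constrained by any of the axioms below and is never used for them. It is only
  meaningful for \<open>complex_alg\<close> and \<open>unitization\<close>.
\<close>

record 'c star_alg = "(complex, 'c) module" +
  adj :: "'c \<Rightarrow> 'c"

record 'c cstar_alg = "'c star_alg" +
  nrm :: "'c \<Rightarrow> real"

definition complex_alg :: "complex star_alg" where
  "complex_alg = \<lparr>carrier = UNIV, monoid.mult = (*), one = 1, zero = 0, add = (+), smult = (*), adj = cnj\<rparr>"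

locale star_algebra = Module.module complex_alg C for C :: "('c, 'm) star_alg_scheme" (structure) +
  assumes m_closed: "\<lbrakk>x \<in> carrier C; y \<in> carrier C\<rbrakk> \<Longrightarrow> x \<otimes> y \<in> carrier C"
    and m_assoc: "\<lbrakk>x \<in> carrier C; y \<in> carrier C; z \<in> carrier C\<rbrakk> \<Longrightarrow> (x \<otimes> y) \<otimes> z = x \<otimes> (y \<otimes> z)"
    and m_l_distr: "\<lbrakk>x \<in> carrier C; y \<in> carrier C; z \<in> carrier C\<rbrakk>
        \<Longrightarrow> (x \<oplus> y) \<otimes> z = x \<otimes> z \<oplus> y \<otimes> z"
    and m_r_distr: "\<lbrakk>x \<in> carrier C; y \<in> carrier C; z \<in> carrier C\<rbrakk>
        \<Longrightarrow> z \<otimes> (x \<oplus> y) = z \<otimes> x \<oplus> z \<otimes> y"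
    and smult_m_left: "\<lbrakk>x \<in> carrier C; y \<in> carrier C\<rbrakk> \<Longrightarrow> (c \<odot> x) \<otimes> y = c \<odot> (x \<otimes> y)"
    and smult_m_right: "\<lbrakk>x \<in> carrier C; y \<in> carrier C\<rbrakk> \<Longrightarrow> x \<otimes> (c \<odot> y) = c \<odot> (x \<otimes> y)"
    and adj_closed: "x \<in> carrier C \<Longrightarrow> adj C x \<in> carrier C"
    and adj_adj: "x \<in> carrier C \<Longrightarrow> adj C (adj C x) = x"
    and adj_add: "\<lbrakk>x \<in> carrier C; y \<in> carrier C\<rbrakk> \<Longrightarrow> adj C (x \<oplus> y) = adj C x \<oplus> adj C y"
    and adj_smult: "x \<in> carrier C \<Longrightarrow> adj C (c \<odot> x) = cnj c \<odot> adj C x"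
    and adj_mult: "\<lbrakk>x \<in> carrier C; y \<in> carrier C\<rbrakk> \<Longrightarrow> adj C (x \<otimes> y) = adj C y \<otimes> adj C x"

definition norm_limit :: "('c, 'm) cstar_alg_scheme \<Rightarrow> (nat \<Rightarrow> 'c) \<Rightarrow> 'c \<Rightarrow> bool" where
  "norm_limit C X x \<longleftrightarrow> (\<lambda>n. nrm C (X n \<ominus>\<^bsub>C\<^esub> x)) \<longlonglongrightarrow> 0"

locale cstar_algebra = star_algebra C for C :: "('c, 'm) cstar_alg_scheme" (structure) +
  assumes nrm_nonneg: "x \<in> carrier C \<Longrightarrow> 0 \<le> nrm C x"
    and nrm_eq_0: "x \<in> carrier C \<Longrightarrow> nrm C x = 0 \<longleftrightarrow> x = \<zero>"
    and nrm_smult: "x \<in> carrier C \<Longrightarrow> nrm C (c \<odot> x) = cmod c * nrm C x"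
    and nrm_triangle: "\<lbrakk>x \<in> carrier C; y \<in> carrier C\<rbrakk> \<Longrightarrow> nrm C (x \<oplus> y) \<le> nrm C x + nrm C y"
    and nrm_mult: "\<lbrakk>x \<in> carrier C; y \<in> carrier C\<rbrakk> \<Longrightarrow> nrm C (x \<otimes> y) \<le> nrm C x * nrm C y"
    and cstar_identity: "x \<in> carrier C \<Longrightarrow> nrm C (adj C x \<otimes> x) = (nrm C x)\<^sup>2"
    and complete: "\<lbrakk>range X \<subseteq> carrier C;
          \<And>\<epsilon>. \<epsilon> > 0 \<Longrightarrow> \<exists>N. \<forall>m\<ge>N. \<forall>n\<ge>N. nrm C (X m \<ominus> X n) < \<epsilon>\<rbrakk>
        \<Longrightarrow> \<exists>x\<in>carrier C. norm_limit C X x"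

definition star_hom :: "('c, 'm) star_alg_scheme \<Rightarrow> ('d, 'n) star_alg_scheme \<Rightarrow> ('c \<Rightarrow> 'd) set" where
  "star_hom C D = {h \<in> carrier C \<rightarrow> carrier D.
     (\<forall>x\<in>carrier C. \<forall>y\<in>carrier C. h (x \<oplus>\<^bsub>C\<^esub> y) = h x \<oplus>\<^bsub>D\<^esub> h y \<and> h (x \<otimes>\<^bsub>C\<^esub> y) = h x \<otimes>\<^bsub>D\<^esub> h y) \<and>
     (\<forall>c. \<forall>x\<in>carrier C. h (c \<odot>\<^bsub>C\<^esub> x) = c \<odot>\<^bsub>D\<^esub> h x) \<and>
     (\<forall>x\<in>carrier C. h (adj C x) = adj D (h x))}"

definition cstar_subalgebra :: "('c, 'm) cstar_alg_scheme \<Rightarrow> 'c set \<Rightarrow> bool" where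
  "cstar_subalgebra C T \<longleftrightarrow> T \<subseteq> carrier C \<and> \<zero>\<^bsub>C\<^esub> \<in> T \<and>
     (\<forall>x\<in>T. \<forall>y\<in>T. x \<oplus>\<^bsub>C\<^esub> y \<in> T \<and> x \<otimes>\<^bsub>C\<^esub> y \<in> T) \<and>
     (\<forall>c. \<forall>x\<in>T. c \<odot>\<^bsub>C\<^esub> x \<in> T) \<and> (\<forall>x\<in>T. adj C x \<in> T) \<and>
     (\<forall>X. \<forall>x\<in>carrier C. range X \<subseteq> T \<longrightarrow> norm_limit C X x \<longrightarrow> x \<in> T)"


section \<open>Graph $C^*$-algebras\<close>

text \<open>The source map is \<^const>\<open>tail\<close>, the range map is \<^const>\<open>head\<close>, and
  \<^term>\<open>in_arcs G v\<close> is $r^{-1}(v)$.\<close>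

locale row_finite_digraph = wf_digraph G for G :: "('v, 'e) pre_digraph" +
  assumes countable_verts: "countable (verts G)"
    and countable_arcs: "countable (arcs G)"
    and row_finite: "v \<in> verts G \<Longrightarrow> finite (in_arcs G v)"

text \<open>``As many edges'' is expressed by equipollence of the edge sets.\<close>

definition arcs_from_to :: "('v, 'e) pre_digraph \<Rightarrow> 'v \<Rightarrow> 'v \<Rightarrow> 'e set" where
  "arcs_from_to G v w = {e \<in> arcs G. tail G e = v \<and> head G e = w}"

definition graph_automorphism :: "('v, 'e) pre_digraph \<Rightarrow> ('v \<Rightarrow> 'v) \<Rightarrow> bool" where
  "graph_automorphism G \<psi> \<longleftrightarrow> bij_betw \<psi> (verts G) (verts G) \<and>
     (\<forall>v\<in>verts G. \<forall>w\<in>verts G. arcs_from_to G v w \<approx> arcs_from_to G (\<psi> v) (\<psi> w))"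

definition graph_family ::
  "('v, 'e) pre_digraph \<Rightarrow> ('c, 'm) star_alg_scheme \<Rightarrow> ('v \<Rightarrow> 'c) \<Rightarrow> ('e \<Rightarrow> 'c) \<Rightarrow> bool" where
  "graph_family G C p S \<longleftrightarrow>
     (\<forall>v\<in>verts G. p v \<in> carrier C \<and> adj C (p v) = p v \<and> p v \<otimes>\<^bsub>C\<^esub> p v = p v) \<and>
     (\<forall>v\<in>verts G. \<forall>w\<in>verts G. v \<noteq> w \<longrightarrow> p v \<otimes>\<^bsub>C\<^esub> p w = \<zero>\<^bsub>C\<^esub>) \<and>
     (\<forall>e\<in>arcs G. S e \<in> carrier C \<and> S e \<otimes>\<^bsub>C\<^esub> adj C (S e) \<otimes>\<^bsub>C\<^esub> S e = S e \<and>
        adj C (S e) \<otimes>\<^bsub>C\<^esub> S e = p (tail G e)) \<and>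
     (\<forall>v\<in>verts G. in_arcs G v \<noteq> {} \<longrightarrow>
        (\<Oplus>\<^bsub>C\<^esub>e\<in>in_arcs G v. S e \<otimes>\<^bsub>C\<^esub> adj C (S e)) = p v)"

text \<open>
  \<open>(C, p, S)\<close> is the universal $C^*$-algebra $C^*(G)$ with its generators. Since one cannot quantify
  over types, the test algebras \<open>D\<close> of the universal property have their carrier in
  \<^typ>\<open>nat \<Rightarrow> complex\<close>. This is no restriction: \<open>G\<close> is countable, so
  the $C^*$-algebra generated by a \<open>G\<close>-family in an arbitrary $C^*$-algebra is separable,
  hence has at most the cardinality of the continuum and is isomorphic to such a \<open>D\<close>.
  Uniqueness of the homomorphism follows from \<open>C\<close> being generated by the family.
\<close>

definition graph_cstar_algebra ::
  "('v, 'e) pre_digraph \<Rightarrow> ('c, 'm) cstar_alg_scheme \<Rightarrow> ('v \<Rightarrow> 'c) \<Rightarrow> ('e \<Rightarrow> 'c) \<Rightarrow> bool" where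
  "graph_cstar_algebra G C p S \<longleftrightarrow>
     row_finite_digraph G \<and> cstar_algebra C \<and> graph_family G C p S \<and>
     (\<forall>T. cstar_subalgebra C T \<and> p ` verts G \<subseteq> T \<and> S ` arcs G \<subseteq> T \<longrightarrow> T = carrier C) \<and>
     (\<forall>(D :: (nat \<Rightarrow> complex) cstar_alg) q R. cstar_algebra D \<and> graph_family G D q R \<longrightarrow>
        (\<exists>h\<in>star_hom C D. (\<forall>v\<in>verts G. h (p v) = q v) \<and> (\<forall>e\<in>arcs G. h (S e) = R e)))"


section \<open>The group $K_0$ of a $C^*$-algebra\<close>

text \<open>
  An \<open>m \<times> n\<close> matrix is a function of two indices that is zero outside of the
  index range. An element \<open>(n, p)\<close> of \<open>projections B\<close> is a projection \<open>p\<close> in $M_n(B)$.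
\<close>

definition matrices :: "('b, 'm) star_alg_scheme \<Rightarrow> nat \<Rightarrow> nat \<Rightarrow> (nat \<Rightarrow> nat \<Rightarrow> 'b) set" where
  "matrices B m n = {x. \<forall>i j. if i < m \<and> j < n then x i j \<in> carrier B else x i j = \<zero>\<^bsub>B\<^esub>}"

text \<open>In \<open>mat_prod B k x y\<close>, \<open>k\<close> is the common inner dimension.\<close>

definition mat_prod ::
  "('b, 'm) star_alg_scheme \<Rightarrow> nat \<Rightarrow> (nat \<Rightarrow> nat \<Rightarrow> 'b) \<Rightarrow> (nat \<Rightarrow> nat \<Rightarrow> 'b) \<Rightarrow> nat \<Rightarrow> nat \<Rightarrow> 'b" where
  "mat_prod B k x y = (\<lambda>i j. \<Oplus>\<^bsub>B\<^esub>l\<in>{..<k}. x i l \<otimes>\<^bsub>B\<^esub> y l j)"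

definition mat_adj :: "('b, 'm) star_alg_scheme \<Rightarrow> (nat \<Rightarrow> nat \<Rightarrow> 'b) \<Rightarrow> nat \<Rightarrow> nat \<Rightarrow> 'b" where
  "mat_adj B x = (\<lambda>i j. adj B (x j i))"

type_synonym 'b mat_elt = "nat \<times> (nat \<Rightarrow> nat \<Rightarrow> 'b)"

definition projections :: "('b, 'm) star_alg_scheme \<Rightarrow> 'b mat_elt set" where
  "projections B = {(n, p). p \<in> matrices B n n \<and> mat_adj B p = p \<and> mat_prod B n p p = p}"

definition zero_proj :: "('b, 'm) star_alg_scheme \<Rightarrow> 'b mat_elt" where
  "zero_proj B = (0, \<lambda>i j. \<zero>\<^bsub>B\<^esub>)"

definition mvn_equiv :: "('b, 'm) star_alg_scheme \<Rightarrow> 'b mat_elt \<Rightarrow> 'b mat_elt \<Rightarrow> bool" where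
  "mvn_equiv B = (\<lambda>(n, p) (m, q). \<exists>v\<in>matrices B m n.
     mat_prod B m (mat_adj B v) v = p \<and> mat_prod B n v (mat_adj B v) = q)"

definition diag_sum :: "('b, 'm) star_alg_scheme \<Rightarrow> 'b mat_elt \<Rightarrow> 'b mat_elt \<Rightarrow> 'b mat_elt" where
  "diag_sum B = (\<lambda>(n, p) (m, q). (n + m, \<lambda>i j.
     if i < n \<and> j < n then p i j else if n \<le> i \<and> n \<le> j then q (i - n) (j - n) else \<zero>\<^bsub>B\<^esub>))"

text \<open>
  \<open>K00 B\<close> is the Grothendieck group of the semigroup of Murray--von Neumann classes of projections
  over \<open>B\<close>; a pair \<open>(p, q)\<close> stands for the formal difference $[p] - [q]$.
  For unital \<open>B\<close> this is $K_0(B)$.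
\<close>

definition groth_rel :: "('b, 'm) star_alg_scheme \<Rightarrow> (('b mat_elt \<times> 'b mat_elt) \<times> ('b mat_elt \<times> 'b mat_elt)) set" where
  "groth_rel B = {((p, q), (p', q')). {p, q, p', q'} \<subseteq> projections B \<and>
     (\<exists>r\<in>projections B. mvn_equiv B (diag_sum B (diag_sum B p q') r) (diag_sum B (diag_sum B p' q) r))}"

type_synonym 'b K00_elt = "('b mat_elt \<times> 'b mat_elt) set"

definition K00 :: "('b, 'm) star_alg_scheme \<Rightarrow> 'b K00_elt monoid" where
  "K00 B = \<lparr>carrier = (projections B \<times> projections B) // groth_rel B,
     monoid.mult = (\<lambda>X Y. \<Union>(p, q)\<in>X. \<Union>(p', q')\<in>Y. groth_rel B `` {(diag_sum B p p', diag_sum B q q')}),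
     one = groth_rel B `` {(zero_proj B, zero_proj B)}\<rparr>"

definition K00_map :: "('d, 'n) star_alg_scheme \<Rightarrow> ('b \<Rightarrow> 'd)
    \<Rightarrow> 'b K00_elt \<Rightarrow> 'd K00_elt" where
  "K00_map D f X = (\<Union>((n, p), (m, q))\<in>X.
     groth_rel D `` {((n, \<lambda>i j. f (p i j)), (m, \<lambda>i j. f (q i j)))})"

text \<open>The unitization only carries its $*$-algebra structure, as the norm plays no
  role in the definition of $K_0$.\<close>

definition unitization :: "('c, 'm) star_alg_scheme \<Rightarrow> ('c \<times> complex) star_alg" where
  "unitization C = \<lparr>carrier = carrier C \<times> UNIV,
     monoid.mult = (\<lambda>(a, x) (b, y). (a \<otimes>\<^bsub>C\<^esub> b \<oplus>\<^bsub>C\<^esub> x \<odot>\<^bsub>C\<^esub> b \<oplus>\<^bsub>C\<^esub> y \<odot>\<^bsub>C\<^esub> a, x * y)),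
     one = (\<zero>\<^bsub>C\<^esub>, 1), zero = (\<zero>\<^bsub>C\<^esub>, 0),
     add = (\<lambda>(a, x) (b, y). (a \<oplus>\<^bsub>C\<^esub> b, x + y)),
     smult = (\<lambda>c (a, x). (c \<odot>\<^bsub>C\<^esub> a, c * x)),
     adj = (\<lambda>(a, x). (adj C a, cnj x))\<rparr>"

text \<open>$K_0(C)$ is the kernel of the map $K_0(\tilde C) \to K_0(\mathbb{C})$ induced by the
  canonical character $\tilde C \to \mathbb{C}$ of the unitization.\<close>

definition K0 :: "('c, 'm) star_alg_scheme
    \<Rightarrow> ('c \<times> complex) K00_elt monoid" where
  "K0 C = (K00 (unitization C))
     \<lparr>carrier := kernel (K00 (unitization C)) (K00 complex_alg) (K00_map complex_alg snd)\<rparr>"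

text \<open>The class $[q]$ of a projection \<open>q\<close> of \<open>C\<close>.\<close>

definition K0_class :: "('c, 'm) star_alg_scheme \<Rightarrow> 'c
    \<Rightarrow> ('c \<times> complex) K00_elt" where
  "K0_class C q = groth_rel (unitization C) ``
     {((1, \<lambda>i j. if i = 0 \<and> j = 0 then (q, 0) else (\<zero>\<^bsub>C\<^esub>, 0)), zero_proj (unitization C))}"


section \<open>The cokernel of $B$ and the action of graph automorphisms\<close>

definition Bmap :: "('v, 'e) pre_digraph \<Rightarrow> ('v \<Rightarrow>\<^sub>0 int) \<Rightarrow> ('v \<Rightarrow>\<^sub>0 int)" where
  "Bmap G = frag_extend (\<lambda>v. frag_of v - (\<Sum>e\<in>in_arcs G v. frag_of (tail G e)))"

definition Bimage :: "('v, 'e) pre_digraph \<Rightarrow> ('v \<Rightarrow>\<^sub>0 int) set" where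
  "Bimage G = Bmap G ` carrier (free_Abelian_group {v \<in> verts G. in_arcs G v \<noteq> {}})"

definition cokerB :: "('v, 'e) pre_digraph \<Rightarrow> ('v \<Rightarrow>\<^sub>0 int) set monoid" where
  "cokerB G = free_Abelian_group (verts G) Mod Bimage G"

definition cokerB_class :: "('v, 'e) pre_digraph \<Rightarrow> 'v \<Rightarrow> ('v \<Rightarrow>\<^sub>0 int) set" where
  "cokerB_class G v = Bimage G #>\<^bsub>free_Abelian_group (verts G)\<^esub> frag_of v"

text \<open>The linear extension of a graph automorphism maps cosets of the image of $B$ onto cosets of
  the image of $B$; this is the map to which it descends.\<close>

definition cokerB_map :: "('v \<Rightarrow> 'v) \<Rightarrow> ('v \<Rightarrow>\<^sub>0 int) set \<Rightarrow> ('v \<Rightarrow>\<^sub>0 int) set" where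
  "cokerB_map \<psi> X = frag_extend (frag_of \<circ> \<psi>) ` X"

text \<open>It is a theorem on graph $C^*$-algebras of row-finite graphs that such a \<open>\<kappa>\<close> always exists. It
  is unique on $K_0(C)$, as the classes of vertices generate $\mathrm{coker}(B)$.\<close>

definition K0_cokerB_iso :: "('v, 'e) pre_digraph \<Rightarrow> ('c, 'm) star_alg_scheme \<Rightarrow> ('v \<Rightarrow> 'c)
    \<Rightarrow> (('c \<times> complex) K00_elt \<Rightarrow> ('v \<Rightarrow>\<^sub>0 int) set) \<Rightarrow> bool" where
  "K0_cokerB_iso G C p \<kappa> \<longleftrightarrow> \<kappa> \<in> iso (K0 C) (cokerB G) \<and>
     (\<forall>v\<in>verts G. \<kappa> (K0_class C (p v)) = cokerB_class G v)"

text \<open>The automorphism $\underline\psi$ of $K_0(C^*(G))$, where \<open>\<kappa>\<close> identifies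
  $K_0(C^*(G))$ with $\mathrm{coker}(B)$.\<close>

definition K0_underline :: "('c, 'm) star_alg_scheme
    \<Rightarrow> (('c \<times> complex) K00_elt \<Rightarrow> ('v \<Rightarrow>\<^sub>0 int) set) \<Rightarrow> ('v \<Rightarrow> 'v)
    \<Rightarrow> ('c \<times> complex) K00_elt
    \<Rightarrow> ('c \<times> complex) K00_elt" where
  "K0_underline C \<kappa> \<psi> x = inv_into (carrier (K0 C)) \<kappa> (cokerB_map \<psi> (\<kappa> x))"


section \<open>The graph $\Gamma(A)$\<close>

datatype 'a gvertex =
  V 'a | U 'a | W1 'a 'a | W2 'a 'a | UU 'a 'a | UUn nat 'a 'a

datatype 'a gedge =
    VtoU 'a | Uloop1 'a | Uloop2 'a
  | VtoW1 'a 'a | VtoW2 'a 'a | W1toUU 'a 'a | W2toUU 'a 'a | UtoUU 'a 'a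
  | UUchain nat 'a 'a  \<comment> \<open>the edge into \<^term>\<open>UUn n a b\<close> from its predecessor\<close>
  | UUloop nat 'a 'a

fun Gamma_source :: "('a, 'm) monoid_scheme \<Rightarrow> 'a gedge \<Rightarrow> 'a gvertex" where
  "Gamma_source A (VtoU c) = V c"
| "Gamma_source A (Uloop1 c) = U c"
| "Gamma_source A (Uloop2 c) = U c"
| "Gamma_source A (VtoW1 a b) = V a"
| "Gamma_source A (VtoW2 a b) = V b"
| "Gamma_source A (W1toUU a b) = W1 a b"
| "Gamma_source A (W2toUU a b) = W2 a b"
| "Gamma_source A (UtoUU a b) = U (a \<otimes>\<^bsub>A\<^esub> b)"
| "Gamma_source A (UUchain n a b) = (if n = 1 then UU a b else UUn (n - 1) a b)"
| "Gamma_source A (UUloop n a b) = UUn n a b"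

fun Gamma_range :: "'a gedge \<Rightarrow> 'a gvertex" where
  "Gamma_range (VtoU c) = U c"
| "Gamma_range (Uloop1 c) = U c"
| "Gamma_range (Uloop2 c) = U c"
| "Gamma_range (VtoW1 a b) = W1 a b"
| "Gamma_range (VtoW2 a b) = W2 a b"
| "Gamma_range (W1toUU a b) = UU a b"
| "Gamma_range (W2toUU a b) = UU a b"
| "Gamma_range (UtoUU a b) = UU a b"
| "Gamma_range (UUchain n a b) = UUn n a b"
| "Gamma_range (UUloop n a b) = UUn n a b"

text \<open>The group \<open>A\<close> is written multiplicatively, as everywhere in HOL-Algebra.\<close>

definition Gamma :: "('a, 'm) monoid_scheme \<Rightarrow> ('a gvertex, 'a gedge) pre_digraph" where
  "Gamma A = \<lparr>
     verts = (\<Union>a\<in>carrier A. {V a, U a}) \<union>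
       (\<Union>a\<in>carrier A. \<Union>b\<in>carrier A. {W1 a b, W2 a b, UU a b} \<union> {UUn n a b | n. n \<ge> 1}),
     arcs = (\<Union>c\<in>carrier A. {VtoU c, Uloop1 c, Uloop2 c}) \<union>
       (\<Union>a\<in>carrier A. \<Union>b\<in>carrier A.
          {VtoW1 a b, VtoW2 a b, W1toUU a b, W2toUU a b, UtoUU a b} \<union>
          {UUchain n a b | n. n \<ge> 1} \<union> {UUloop n a b | n. n \<ge> 1}),
     tail = Gamma_source A, head = Gamma_range\<rparr>"

fun Gamma_map :: "('a \<Rightarrow> 'a) \<Rightarrow> 'a gvertex \<Rightarrow> 'a gvertex" where
  "Gamma_map \<phi> (V a) = V (\<phi> a)"
| "Gamma_map \<phi> (U a) = U (\<phi> a)"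
| "Gamma_map \<phi> (W1 a b) = W1 (\<phi> a) (\<phi> b)"
| "Gamma_map \<phi> (W2 a b) = W2 (\<phi> a) (\<phi> b)"
| "Gamma_map \<phi> (UU a b) = UU (\<phi> a) (\<phi> b)"
| "Gamma_map \<phi> (UUn n a b) = UUn n (\<phi> a) (\<phi> b)"

lemma wf_digraph_Gamma:
  assumes "comm_group A"
  shows "wf_digraph (Gamma A)"
proof
  interpret comm_group A by fact
  fix e assume "e \<in> arcs (Gamma A)"
  then show "tail (Gamma A) e \<in> verts (Gamma A)" "head (Gamma A) e \<in> verts (Gamma A)"
    by (cases e; auto simp: Gamma_def split: if_splits)+
qed

lemma row_finite_Gamma:
  assumes "comm_group A" "countable (carrier A)"
  shows "row_finite_digraph (Gamma A)"
proof -
  interpret comm_group A by fact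
  have cU: "countable {f n a b | n. n \<ge> (1::nat)}" for f :: "nat \<Rightarrow> 'a \<Rightarrow> 'a \<Rightarrow> 'x" and a b
    by (rule countable_subset[of _ "range (\<lambda>n. f n a b)"]) auto
  interpret wf_digraph "Gamma A" using assms(1) by (rule wf_digraph_Gamma)
  show ?thesis
  proof
    show "countable (verts (Gamma A))" "countable (arcs (Gamma A))"
      unfolding Gamma_def by (auto intro!: countable_UN assms(2) cU[simplified])
  next
    fix v assume "v \<in> verts (Gamma A)"
    have *: "in_arcs (Gamma A) v \<subseteq> (case v of V c \<Rightarrow> {} | U c \<Rightarrow> {VtoU c, Uloop1 c, Uloop2 c}
       | W1 a b \<Rightarrow> {VtoW1 a b} | W2 a b \<Rightarrow> {VtoW2 a b}
       | UU a b \<Rightarrow> {W1toUU a b, W2toUU a b, UtoUU a b} | UUn n a b \<Rightarrow> {UUchain n a b, UUloop n a b})"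
      by (auto simp: in_arcs_def Gamma_def)
    have "finite (case v of V c \<Rightarrow> {} | U c \<Rightarrow> {VtoU c, Uloop1 c, Uloop2 c}
       | W1 a b \<Rightarrow> {VtoW1 a b} | W2 a b \<Rightarrow> {VtoW2 a b}
       | UU a b \<Rightarrow> {W1toUU a b, W2toUU a b, UtoUU a b} | UUn n a b \<Rightarrow> {UUchain n a b, UUloop n a b})"
      by (cases v) auto
    then show "finite (in_arcs (Gamma A) v)" using * finite_subset by blast
  qed
qed

lemma graph_automorphism_Gamma_map:
  assumes "comm_group A" "\<phi> \<in> iso A A"
  shows "graph_automorphism (Gamma A) (Gamma_map \<phi>)"
proof -
  interpret comm_group A by fact
  have hom: "\<And>a b. a \<in> carrier A \<Longrightarrow> b \<in> carrier A \<Longrightarrow> \<phi> (a \<otimes>\<^bsub>A\<^esub> b) = \<phi> a \<otimes>\<^bsub>A\<^esub> \<phi> b"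
    and bij: "bij_betw \<phi> (carrier A) (carrier A)"
    using assms(2) by (auto simp: iso_def hom_def)
  have inj: "\<And>a b. a \<in> carrier A \<Longrightarrow> b \<in> carrier A \<Longrightarrow> \<phi> a = \<phi> b \<longleftrightarrow> a = b"
    using bij by (auto simp: bij_betw_def inj_on_def)
  have cl: "\<And>a. a \<in> carrier A \<Longrightarrow> \<phi> a \<in> carrier A" using bij by (auto simp: bij_betw_def)
  let ?i = "inv_into (carrier A) \<phi>"
  have i: "\<And>a. a \<in> carrier A \<Longrightarrow> ?i a \<in> carrier A" "\<And>a. a \<in> carrier A \<Longrightarrow> \<phi> (?i a) = a"
    using bij by (auto simp: bij_betw_def inv_into_into f_inv_into_f)
  let ?E = "map_gedge \<phi>"
  have V: "bij_betw (Gamma_map \<phi>) (verts (Gamma A)) (verts (Gamma A))"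
    unfolding bij_betw_def
  proof (intro conjI subset_antisym subsetI)
    show "inj_on (Gamma_map \<phi>) (verts (Gamma A))"
    proof (rule inj_onI)
      fix x y assume "x \<in> verts (Gamma A)" "y \<in> verts (Gamma A)" "Gamma_map \<phi> x = Gamma_map \<phi> y"
      then show "x = y" by (cases x; cases y) (auto simp: Gamma_def inj)
    qed
    fix x
    show "x \<in> Gamma_map \<phi> ` verts (Gamma A) \<Longrightarrow> x \<in> verts (Gamma A)"
      by (auto simp: Gamma_def cl)
    assume x: "x \<in> verts (Gamma A)"
    have "\<exists>y\<in>verts (Gamma A). x = Gamma_map \<phi> y"
      by (rule bexI[of _ "Gamma_map ?i x"]) (use x in \<open>auto simp: Gamma_def i\<close>)
    then show "x \<in> Gamma_map \<phi> ` verts (Gamma A)" by blast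
  qed
  have src: "tail (Gamma A) (?E e) = Gamma_map \<phi> (tail (Gamma A) e)"
    and rng: "head (Gamma A) (?E e) = Gamma_map \<phi> (head (Gamma A) e)" if "e \<in> arcs (Gamma A)" for e
    using that by (auto simp: Gamma_def hom)
  have E: "?E e \<in> arcs (Gamma A)" if "e \<in> arcs (Gamma A)" for e
    using that by (auto simp: Gamma_def cl)
  have Einj: "inj_on ?E (arcs (Gamma A))"
  proof (rule inj_onI)
    fix x y assume "x \<in> arcs (Gamma A)" "y \<in> arcs (Gamma A)" "?E x = ?E y"
    then show "x = y" by (cases x; cases y) (auto simp: Gamma_def inj)
  qed
  have Esur: "\<exists>e'\<in>arcs (Gamma A). e = ?E e'" if "e \<in> arcs (Gamma A)" for e
  proof -
    show ?thesis
      by (rule bexI[of _ "map_gedge ?i e"]) (use that in \<open>auto simp: Gamma_def i\<close>)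
  qed
  have "arcs_from_to (Gamma A) v w \<approx> arcs_from_to (Gamma A) (Gamma_map \<phi> v) (Gamma_map \<phi> w)"
    if "v \<in> verts (Gamma A)" "w \<in> verts (Gamma A)" for v w
    unfolding eqpoll_def
  proof (rule exI[of _ ?E], unfold bij_betw_def, intro conjI subset_antisym subsetI)
    show "inj_on ?E (arcs_from_to (Gamma A) v w)"
      using Einj by (rule inj_on_subset) (auto simp: arcs_from_to_def)
    show "x \<in> arcs_from_to (Gamma A) (Gamma_map \<phi> v) (Gamma_map \<phi> w)"
      if "x \<in> ?E ` arcs_from_to (Gamma A) v w" for x
      using that by (auto simp: arcs_from_to_def src rng E)
    show "x \<in> ?E ` arcs_from_to (Gamma A) v w"
      if x: "x \<in> arcs_from_to (Gamma A) (Gamma_map \<phi> v) (Gamma_map \<phi> w)" for x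
    proof -
      from x obtain e where e: "e \<in> arcs (Gamma A)" "x = ?E e" using Esur by (auto simp: arcs_from_to_def)
      have wf: "tail (Gamma A) e \<in> verts (Gamma A)" "head (Gamma A) e \<in> verts (Gamma A)"
        using e(1) wf_digraph_Gamma[OF assms(1)] by (auto simp: wf_digraph_def)
      have "tail (Gamma A) e = v" "head (Gamma A) e = w"
        using x e src rng V wf \<open>v \<in> _\<close> \<open>w \<in> _\<close> by (auto simp: arcs_from_to_def bij_betw_def inj_on_def)
      then show ?thesis using e by (auto simp: arcs_from_to_def)
    qed
  qed
  with V show ?thesis by (auto simp: graph_automorphism_def)
qed

text \<open>The identification of $K_0(C^*(\Gamma(A)))$ with \<open>A\<close>. There is at most one, since
  a bijective \<open>\<theta>\<close> with this property forces every class to be of the form $[p_{v_a}]$.\<close>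

definition K0_Gamma_iso :: "('a, 'n) monoid_scheme \<Rightarrow> ('c, 'm) star_alg_scheme \<Rightarrow> ('a gvertex \<Rightarrow> 'c)
    \<Rightarrow> (('c \<times> complex) K00_elt \<Rightarrow> 'a) \<Rightarrow> bool" where
  "K0_Gamma_iso A C p \<theta> \<longleftrightarrow> \<theta> \<in> iso (K0 C) A \<and> (\<forall>a\<in>carrier A. \<theta> (K0_class C (p (V a))) = a)"

end

theory Submission
  imports Defs
begin

text \<open>
  The theorem combines a computation in a cokernel with the fact that the classes $[p_v]$ really
  are elements of $K_0$.

  In $\mathrm{coker}(B)$ the relation at $u_c$ reads $v_c + u_c = 0$, the relations at the two
  vertices $w$ identify these with $v_a$ and $v_b$, and the relations at the chain
  $u^1_{ab}, u^2_{ab}, \dots$ kill $u_{ab}$ and every $u^n_{ab}$. What the relation at $u_{ab}$ then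
  says is $v_a + v_b = v_{a+b}$. Hence \<open>a \<mapsto> [v_a]\<close> is a surjective homomorphism from \<open>A\<close> onto
  the cokernel (\<open>free_element_congruent_V\<close>). It is injective because sending every vertex to the element
  of \<open>A\<close> that these relations dictate for it (\<open>vertex_value\<close>) defines a homomorphism on
  $\mathbb{Z}V$ that vanishes on the image of $B$ (\<open>Bimage_Gamma_V_inj\<close>). Composing $\kappa$ with the
  inverse of this isomorphism \<open>cokerB_Gamma_iso\<close> gives the identification of $K_0$ with \<open>A\<close>.

  The linear extension of a graph automorphism maps the relation at $v$ to the relation at
  $\psi(v)$, so the induced map of the cokernel sends $[v]$ to $[\psi(v)]$ (\<open>cokerB_map_class\<close>). As
  every element of $\mathrm{coker}(B)$ is some $[v_a]$, and $\Gamma(\phi)$ sends $v_a$ to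
  $v_{\phi(a)}$, the theorem follows by comparing both sides at $[p_{v_a}]$.

  This comparison pulls the equality $\kappa(x) = [v_a]$ back to $x = [p_{v_a}]$, and $\kappa$ is
  injective only on the carrier of $K_0$. So $[p_{v_a}]$ has to be shown to lie in the kernel of
  $K_0(\tilde C) \to K_0(\mathbb{C})$ (\<open>K0_class_in_K0\<close>). That kernel is a set of equivalence classes
  on which the map is given by representatives, so this needs that \<open>groth_rel\<close> is an equivalence
  relation (\<open>equiv_groth_rel\<close>) and that $*$-homomorphisms respect it (\<open>K00_map_class\<close>). The former is
  the usual argument for the Grothendieck group of a commutative semigroup, once the
  Murray--von Neumann classes are known to form one (\<open>comm_monoid_mvn_monoid\<close>).
\<close>

section \<open>Matrices over a $*$-algebra\<close>

text \<open>
  The common source of distributivity over finite sums, of the additivity of the adjoint, and of the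
  compatibility of $*$-homomorphisms with matrix products. The algebras need not have a unit, so the
  corresponding facts about rings cannot be used.
\<close>

lemma finsum_additive_map:
  assumes "abelian_monoid C" "abelian_monoid D" "h \<in> carrier C \<rightarrow> carrier D"
    and "h \<zero>\<^bsub>C\<^esub> = \<zero>\<^bsub>D\<^esub>"
    and "\<And>x y. x \<in> carrier C \<Longrightarrow> y \<in> carrier C \<Longrightarrow> h (x \<oplus>\<^bsub>C\<^esub> y) = h x \<oplus>\<^bsub>D\<^esub> h y"
    and "f \<in> A \<rightarrow> carrier C"
  shows "h (finsum C f A) = (\<Oplus>\<^bsub>D\<^esub>i\<in>A. h (f i))"
proof -
  interpret C: abelian_monoid C by fact
  interpret D: abelian_monoid D by fact
  show ?thesis
    using assms(6)
  proof (induction A rule: infinite_finite_induct)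
    case (insert a A)
    then have "f \<in> A \<rightarrow> carrier C" "f a \<in> carrier C" by auto
    moreover have "(\<lambda>i. h (f i)) \<in> A \<rightarrow> carrier D" "h (f a) \<in> carrier D"
      using insert.prems assms(3) by auto
    ultimately show ?case using insert assms(5) by simp
  qed (simp_all add: assms(4))
qed

lemma abelian_monoid_finsum_zeroI:
  assumes "abelian_monoid C" "\<And>i. i \<in> A \<Longrightarrow> f i = \<zero>\<^bsub>C\<^esub>"
  shows "finsum C f A = \<zero>\<^bsub>C\<^esub>"
proof -
  interpret abelian_monoid C by fact
  show ?thesis by (rule add.finprod_one_eqI) (rule assms(2))
qed

context star_algebra
begin

lemma scalar [simp]: "c \<in> carrier complex_alg"
  by (simp add: complex_alg_def)

lemma abelian_monoid_C: "abelian_monoid C" ..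

declare m_closed [simp] adj_closed [simp] adj_adj [simp]

lemma smult_zero_scalar: "x \<in> carrier C \<Longrightarrow> 0 \<odot> x = \<zero>"
  using smult_l_null[of x] by (simp add: complex_alg_def)

lemma m_l_null [simp]: "x \<in> carrier C \<Longrightarrow> \<zero> \<otimes> x = \<zero>"
  using smult_m_left[of \<zero> x 0] smult_zero_scalar[of \<zero>] smult_zero_scalar[of "\<zero> \<otimes> x"] by simp

lemma m_r_null [simp]: "x \<in> carrier C \<Longrightarrow> x \<otimes> \<zero> = \<zero>"
  using smult_m_right[of x \<zero> 0] smult_zero_scalar[of \<zero>] smult_zero_scalar[of "x \<otimes> \<zero>"] by simp

lemma adj_zero [simp]: "adj C \<zero> = \<zero>"
  using adj_smult[of \<zero> 0] smult_zero_scalar[of \<zero>] smult_zero_scalar[of "adj C \<zero>"] by simp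

lemma finsum_m_left:
  "x \<in> carrier C \<Longrightarrow> f \<in> A \<rightarrow> carrier C \<Longrightarrow> x \<otimes> finsum C f A = (\<Oplus>i\<in>A. x \<otimes> f i)"
  by (rule finsum_additive_map[OF abelian_monoid_C abelian_monoid_C, where h = "\<lambda>y. x \<otimes> y"]) (auto intro: m_r_distr)

lemma finsum_m_right:
  "x \<in> carrier C \<Longrightarrow> f \<in> A \<rightarrow> carrier C \<Longrightarrow> finsum C f A \<otimes> x = (\<Oplus>i\<in>A. f i \<otimes> x)"
  by (rule finsum_additive_map[OF abelian_monoid_C abelian_monoid_C, where h = "\<lambda>y. y \<otimes> x"]) (auto intro: m_l_distr)

lemma finsum_adj:
  "f \<in> A \<rightarrow> carrier C \<Longrightarrow> adj C (finsum C f A) = (\<Oplus>i\<in>A. adj C (f i))"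
  by (rule finsum_additive_map[OF abelian_monoid_C abelian_monoid_C]) (auto intro: adj_add)

lemma finsum_swap:
  assumes "finite B" "\<And>i j. i \<in> A \<Longrightarrow> j \<in> B \<Longrightarrow> f i j \<in> carrier C"
  shows "(\<Oplus>i\<in>A. \<Oplus>j\<in>B. f i j) = (\<Oplus>j\<in>B. \<Oplus>i\<in>A. f i j)"
  using assms
proof (induction B rule: finite_induct)
  case empty
  then show ?case by simp
next
  case (insert b B)
  have "(\<Oplus>i\<in>A. \<Oplus>j\<in>insert b B. f i j) = (\<Oplus>i\<in>A. f i b \<oplus> (\<Oplus>j\<in>B. f i j))"
    using insert by (intro M.finsum_cong') auto
  also have "\<dots> = (\<Oplus>i\<in>A. f i b) \<oplus> (\<Oplus>i\<in>A. \<Oplus>j\<in>B. f i j)"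
    using insert by (intro M.finsum_addf) auto
  also have "\<dots> = (\<Oplus>j\<in>insert b B. \<Oplus>i\<in>A. f i j)"
    using insert by (subst M.finsum_insert) auto
  finally show ?case .
qed

lemma matrices_entry [simp]: "x \<in> matrices C m n \<Longrightarrow> x i j \<in> carrier C"
  by (cases "i < m \<and> j < n") (auto simp: matrices_def)

text \<open>
  Vanishing outside of the index range makes matrices of a given size equal as functions as soon as
  they agree within the range; it also keeps sums over larger index ranges correct.
\<close>

lemma matrices_outside: "x \<in> matrices C m n \<Longrightarrow> \<not> (i < m \<and> j < n) \<Longrightarrow> x i j = \<zero>"
  unfolding matrices_def by (cases "i < m \<and> j < n") auto

lemma matrices_eqI:
  assumes "x \<in> matrices C m n" "y \<in> matrices C m n"
    and "\<And>i j. i < m \<Longrightarrow> j < n \<Longrightarrow> x i j = y i j"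
  shows "x = y"
proof (intro ext)
  fix i j
  show "x i j = y i j"
    using assms matrices_outside[OF assms(1), of i j] matrices_outside[OF assms(2), of i j]
    by (cases "i < m \<and> j < n") auto
qed

lemma mat_prod_closed [intro, simp]:
  assumes "x \<in> matrices C m k" "y \<in> matrices C k n"
  shows "mat_prod C k x y \<in> matrices C m n"
proof -
  have "mat_prod C k x y i j \<in> carrier C" for i j
    using assms by (auto simp: mat_prod_def intro!: M.finsum_closed)
  moreover have "mat_prod C k x y i j = \<zero>" if "\<not> (i < m \<and> j < n)" for i j
    unfolding mat_prod_def
  proof (rule abelian_monoid_finsum_zeroI[OF abelian_monoid_C])
    fix l
    show "x i l \<otimes> y l j = \<zero>"
      using that matrices_outside[OF assms(1), of i l] matrices_outside[OF assms(2), of l j] assms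
      by (cases "i < m") auto
  qed
  ultimately show ?thesis by (simp add: matrices_def)
qed

lemma mat_adj_closed [intro, simp]: "x \<in> matrices C m n \<Longrightarrow> mat_adj C x \<in> matrices C n m"
  by (auto simp: matrices_def mat_adj_def)

lemma mat_adj_adj [simp]: "x \<in> matrices C m n \<Longrightarrow> mat_adj C (mat_adj C x) = x"
  by (intro ext) (simp add: mat_adj_def)

lemma mat_prod_assoc:
  assumes "x \<in> matrices C m k" "y \<in> matrices C k l" "z \<in> matrices C l n"
  shows "mat_prod C l (mat_prod C k x y) z = mat_prod C k x (mat_prod C l y z)"
proof (intro ext)
  fix i j
  note [simp] = assms[THEN matrices_entry]
  have "mat_prod C l (mat_prod C k x y) z i j = (\<Oplus>t\<in>{..<l}. \<Oplus>s\<in>{..<k}. x i s \<otimes> y s t \<otimes> z t j)"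
    unfolding mat_prod_def by (intro M.finsum_cong' finsum_m_right) (auto intro!: M.finsum_closed)
  also have "\<dots> = (\<Oplus>s\<in>{..<k}. \<Oplus>t\<in>{..<l}. x i s \<otimes> y s t \<otimes> z t j)"
    by (rule finsum_swap) auto
  also have "\<dots> = (\<Oplus>s\<in>{..<k}. \<Oplus>t\<in>{..<l}. x i s \<otimes> (y s t \<otimes> z t j))"
    by (intro M.finsum_cong') (auto intro!: M.finsum_closed m_assoc)
  also have "\<dots> = mat_prod C k x (mat_prod C l y z) i j"
    unfolding mat_prod_def
    by (intro M.finsum_cong' finsum_m_left[symmetric]) (auto intro!: M.finsum_closed)
  finally show "mat_prod C l (mat_prod C k x y) z i j = mat_prod C k x (mat_prod C l y z) i j" .
qed

lemma mat_adj_prod: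
  assumes "x \<in> matrices C m k" "y \<in> matrices C k n"
  shows "mat_adj C (mat_prod C k x y) = mat_prod C k (mat_adj C y) (mat_adj C x)"
proof (intro ext)
  fix i j
  note [simp] = assms[THEN matrices_entry]
  have "mat_adj C (mat_prod C k x y) i j = (\<Oplus>l\<in>{..<k}. adj C (x j l \<otimes> y l i))"
    by (auto simp: mat_adj_def mat_prod_def intro!: finsum_adj)
  also have "\<dots> = mat_prod C k (mat_adj C y) (mat_adj C x) i j"
    unfolding mat_prod_def mat_adj_def by (intro M.finsum_cong') (auto intro!: adj_mult)
  finally show "mat_adj C (mat_prod C k x y) i j = mat_prod C k (mat_adj C y) (mat_adj C x) i j" .
qed

section \<open>Murray--von Neumann equivalence\<close>

lemma projectionsD:
  assumes "(n, p) \<in> projections C"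
  shows "p \<in> matrices C n n" "mat_adj C p = p" "mat_prod C n p p = p"
  using assms by (auto simp: projections_def)

lemma mvn_equiv_refl: "a \<in> projections C \<Longrightarrow> mvn_equiv C a a"
  by (cases a) (auto simp: mvn_equiv_def projections_def intro!: bexI[of _ "snd a"])

lemma mvn_equiv_sym: "mvn_equiv C a b \<Longrightarrow> mvn_equiv C b a"
proof -
  assume "mvn_equiv C a b"
  then obtain n p m q v where "a = (n, p)" "b = (m, q)" and v: "v \<in> matrices C m n"
    and "mat_prod C m (mat_adj C v) v = p" "mat_prod C n v (mat_adj C v) = q"
    by (cases a, cases b) (auto simp: mvn_equiv_def)
  then show ?thesis
    by (auto simp: mvn_equiv_def intro!: bexI[of _ "mat_adj C v"])
qed

text \<open>
  If $v$ implements $p \sim q$ and $w$ implements $q \sim r$, then $wv$ implements $p \sim r$: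
  $(wv)^*wv = v^*qv = v^*vv^*v = p^2 = p$, and symmetrically for $r$.
\<close>

lemma mvn_equiv_trans:
  assumes "mvn_equiv C a b" "mvn_equiv C b c" "a \<in> projections C" "c \<in> projections C"
  shows "mvn_equiv C a c"
proof -
  obtain n p m q k r where abc: "a = (n, p)" "b = (m, q)" "c = (k, r)"
    by (cases a, cases b, cases c)
  from assms abc obtain v w where v: "v \<in> matrices C m n" and w: "w \<in> matrices C k m"
    and p: "mat_prod C m (mat_adj C v) v = p" and q: "mat_prod C n v (mat_adj C v) = q"
      "mat_prod C k (mat_adj C w) w = q" and r: "mat_prod C m w (mat_adj C w) = r"
    by (auto simp: mvn_equiv_def)
  have va: "mat_adj C v \<in> matrices C n m" and wa: "mat_adj C w \<in> matrices C m k"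
    and wv: "mat_prod C m w v \<in> matrices C k n"
    using v w by auto
  have adj: "mat_adj C (mat_prod C m w v) = mat_prod C m (mat_adj C v) (mat_adj C w)"
    using w v by (rule mat_adj_prod)
  have "mat_prod C k (mat_prod C m (mat_adj C v) (mat_adj C w)) (mat_prod C m w v)
      = mat_prod C m (mat_adj C v) (mat_prod C m (mat_prod C k (mat_adj C w) w) v)"
    by (simp add: mat_prod_assoc[OF va wa wv] mat_prod_assoc[OF wa w v])
  also have "\<dots> = mat_prod C n (mat_prod C m (mat_adj C v) v) (mat_prod C m (mat_adj C v) v)"
    unfolding q(2) q(1)[symmetric] using v va
    by (simp add: mat_prod_assoc[OF va v mat_prod_closed[OF va v]] mat_prod_assoc[OF v va v])
  also have "\<dots> = p"
    using projectionsD(3) assms(3) abc p by blast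
  finally have 1: "mat_prod C k (mat_adj C (mat_prod C m w v)) (mat_prod C m w v) = p"
    by (simp add: adj)
  have "mat_prod C n (mat_prod C m w v) (mat_prod C m (mat_adj C v) (mat_adj C w))
      = mat_prod C m w (mat_prod C m (mat_prod C n v (mat_adj C v)) (mat_adj C w))"
    using v w va wa by (simp add: mat_prod_assoc[OF w v mat_prod_closed[OF va wa]] mat_prod_assoc[OF v va wa])
  also have "\<dots> = mat_prod C k (mat_prod C m w (mat_adj C w)) (mat_prod C m w (mat_adj C w))"
    unfolding q(1) q(2)[symmetric] using w wa
    by (simp add: mat_prod_assoc[OF w wa mat_prod_closed[OF w wa]] mat_prod_assoc[OF wa w wa])
  also have "\<dots> = r"
    using projectionsD(3) assms(4) abc r by blast
  finally have 2: "mat_prod C n (mat_prod C m w v) (mat_adj C (mat_prod C m w v)) = r"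
    by (simp add: adj)
  show ?thesis
    using wv 1 2 abc by (auto simp: mvn_equiv_def)
qed

text \<open>
  Conjugation by a permutation matrix. Without a unit that matrix is not available, but its product
  with $p$ is: the partial isometry is $p$ with its rows permuted.
\<close>

lemma mvn_equiv_relabel:
  assumes "(n, p) \<in> projections C" "bij_betw \<sigma> {..<n} {..<n}" "q \<in> matrices C n n"
    and q: "\<And>i j. i < n \<Longrightarrow> j < n \<Longrightarrow> q i j = p (\<sigma> i) (\<sigma> j)"
  shows "mvn_equiv C (n, p) (n, q)"
proof -
  note p = projectionsD[OF assms(1)]
  note [simp] = p(1)[THEN matrices_entry]
  have adjp [simp]: "adj C (p i j) = p j i" for i j
    using fun_cong[OF fun_cong[OF p(2)]] by (simp add: mat_adj_def)
  have pp: "(\<Oplus>l\<in>{..<n}. p i l \<otimes> p l j) = p i j" for i j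
    using fun_cong[OF fun_cong[OF p(3)]] by (simp add: mat_prod_def)
  \<comment> \<open>The product of the permutation matrix of \<open>\<sigma>\<close> with \<open>p\<close>.\<close>
  define v where "v = (\<lambda>i j. if i < n \<and> j < n then p (\<sigma> i) j else \<zero>)"
  have v: "v \<in> matrices C n n"
    by (auto simp: v_def matrices_def)
  have "mat_prod C n (mat_adj C v) v i j = p i j" if "i < n" "j < n" for i j
  proof -
    have "mat_prod C n (mat_adj C v) v i j = (\<Oplus>l\<in>{..<n}. p i (\<sigma> l) \<otimes> p (\<sigma> l) j)"
      unfolding mat_prod_def mat_adj_def v_def using that by (intro M.finsum_cong') auto
    also have "\<dots> = (\<Oplus>l\<in>\<sigma> ` {..<n}. p i l \<otimes> p l j)"
      using assms(2) by (intro M.finsum_reindex[symmetric]) (auto simp: bij_betw_def)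
    also have "\<dots> = p i j"
      using assms(2) pp by (simp add: bij_betw_def)
    finally show ?thesis .
  qed
  then have "mat_prod C n (mat_adj C v) v = p"
    using v p(1) by (intro matrices_eqI) auto
  moreover have "mat_prod C n v (mat_adj C v) i j = q i j" if "i < n" "j < n" for i j
  proof -
    have "mat_prod C n v (mat_adj C v) i j = (\<Oplus>l\<in>{..<n}. p (\<sigma> i) l \<otimes> p l (\<sigma> j))"
      unfolding mat_prod_def mat_adj_def v_def using that by (intro M.finsum_cong') auto
    then show ?thesis using pp q that by simp
  qed
  then have "mat_prod C n v (mat_adj C v) = q"
    using v assms(3) by (intro matrices_eqI) auto
  ultimately show ?thesis
    using v by (auto simp: mvn_equiv_def)
qed

end

text \<open>
  The rectangular version of \<^const>\<open>diag_sum\<close>; partial isometries between projections of different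
  sizes are rectangular, so a direct sum of them is of this kind.
\<close>

definition block_diag ::
  "('b, 'm) star_alg_scheme \<Rightarrow> nat \<Rightarrow> nat \<Rightarrow> (nat \<Rightarrow> nat \<Rightarrow> 'b) \<Rightarrow> (nat \<Rightarrow> nat \<Rightarrow> 'b) \<Rightarrow> nat \<Rightarrow> nat \<Rightarrow> 'b" where
  "block_diag B m n x y = (\<lambda>i j.
     if i < m \<and> j < n then x i j else if m \<le> i \<and> n \<le> j then y (i - m) (j - n) else \<zero>\<^bsub>B\<^esub>)"

lemma diag_sum_eq: "diag_sum B (n, p) (m, q) = (n + m, block_diag B n n p q)"
  by (simp add: diag_sum_def block_diag_def)

lemma diag_sum_assoc: "diag_sum B (diag_sum B a b) c = diag_sum B a (diag_sum B b c)"
  by (cases a; cases b; cases c)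
    (auto simp: diag_sum_eq block_diag_def fun_eq_iff)

context star_algebra
begin

lemma block_diag_closed [intro, simp]:
  assumes "x \<in> matrices C m n" "y \<in> matrices C m' n'"
  shows "block_diag C m n x y \<in> matrices C (m + m') (n + n')"
proof -
  have "y (i - m) (j - n) = \<zero>" if "m \<le> i" "n \<le> j" "\<not> (i < m + m' \<and> j < n + n')" for i j
    using that by (intro matrices_outside[OF assms(2)]) auto
  then show ?thesis
    using assms by (auto simp: block_diag_def matrices_def)
qed

lemma block_diag_adj: "mat_adj C (block_diag C m n x y) = block_diag C n m (mat_adj C x) (mat_adj C y)"
  by (auto simp: mat_adj_def block_diag_def fun_eq_iff)

text \<open>
  The sum over the common index splits at \<open>k\<close>: the first part only sees the upper blocks,
  the second part only the lower ones.
\<close>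

lemma block_diag_prod:
  assumes x: "x \<in> matrices C m k" and y: "y \<in> matrices C m' k'"
    and x': "x' \<in> matrices C k n" and y': "y' \<in> matrices C k' n'"
  shows "mat_prod C (k + k') (block_diag C m k x y) (block_diag C k n x' y')
    = block_diag C m n (mat_prod C k x x') (mat_prod C k' y y')"
proof (intro ext)
  fix i j
  note [simp] = assms[THEN matrices_entry]
  let ?u = "block_diag C m k x y" and ?u' = "block_diag C k n x' y'"
  have u: "?u i l \<in> carrier C" "?u' l j \<in> carrier C" for l
    using block_diag_closed[OF x y] block_diag_closed[OF x' y'] by auto
  have ul: "?u i l = x i l" "?u' l j = x' l j" if "l < k" for l
    using that matrices_outside[OF x, of i l] matrices_outside[OF x', of l j]
    by (auto simp: block_diag_def)
  have ur: "?u i (l + k) = (if m \<le> i then y (i - m) l else \<zero>)"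
    "?u' (l + k) j = (if n \<le> j then y' l (j - n) else \<zero>)" for l
    by (auto simp: block_diag_def)
  have "(\<lambda>l. l + k) ` {..<k'} = {k..<k + k'}"
    using image_add_atLeastLessThan'[of k 0 k'] by (simp add: atLeast0LessThan add.commute)
  then have "{..<k + k'} = {..<k} \<union> (\<lambda>l. l + k) ` {..<k'}"
    by auto
  then have "mat_prod C (k + k') ?u ?u' i j
      = (\<Oplus>l\<in>{..<k} \<union> (\<lambda>l. l + k) ` {..<k'}. ?u i l \<otimes> ?u' l j)"
    by (simp add: mat_prod_def)
  also have "\<dots> = (\<Oplus>l\<in>{..<k}. ?u i l \<otimes> ?u' l j) \<oplus> (\<Oplus>l\<in>(\<lambda>l. l + k) ` {..<k'}. ?u i l \<otimes> ?u' l j)"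
    using u by (intro M.finsum_Un_disjoint) auto
  also have "(\<Oplus>l\<in>{..<k}. ?u i l \<otimes> ?u' l j) = mat_prod C k x x' i j"
    unfolding mat_prod_def by (intro M.finsum_cong') (auto simp: ul)
  also have "(\<Oplus>l\<in>(\<lambda>l. l + k) ` {..<k'}. ?u i l \<otimes> ?u' l j)
      = (\<Oplus>l\<in>{..<k'}. ?u i (l + k) \<otimes> ?u' (l + k) j)"
    using u by (intro M.finsum_reindex) auto
  also have "\<dots> = (if m \<le> i \<and> n \<le> j then mat_prod C k' y y' (i - m) (j - n) else \<zero>)"
    by (auto simp: ur mat_prod_def intro!: abelian_monoid_finsum_zeroI[OF abelian_monoid_C])
  also have "mat_prod C k x x' i j \<oplus> \<dots> = block_diag C m n (mat_prod C k x x') (mat_prod C k' y y') i j"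
    using matrices_outside[OF mat_prod_closed[OF x x'], of i j]
      matrices_entry[OF mat_prod_closed[OF x x'], of i j]
      matrices_entry[OF mat_prod_closed[OF y y'], of "i - m" "j - n"]
    by (auto simp: block_diag_def)
  finally show "mat_prod C (k + k') ?u ?u' i j
    = block_diag C m n (mat_prod C k x x') (mat_prod C k' y y') i j" .
qed

lemma zero_proj_projections [intro, simp]: "zero_proj C \<in> projections C"
  by (simp add: zero_proj_def projections_def matrices_def mat_adj_def mat_prod_def)

lemma diag_sum_projections [intro, simp]:
  assumes "a \<in> projections C" "b \<in> projections C"
  shows "diag_sum C a b \<in> projections C"
proof -
  obtain n p m q where ab: "a = (n, p)" "b = (m, q)" by (cases a, cases b)
  note p = projectionsD[OF assms(1)[unfolded ab]] and q = projectionsD[OF assms(2)[unfolded ab]]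
  have "mat_prod C (n + m) (block_diag C n n p q) (block_diag C n n p q) = block_diag C n n p q"
    by (simp only: block_diag_prod[OF p(1) q(1) p(1) q(1)] p(3) q(3))
  moreover have "mat_adj C (block_diag C n n p q) = block_diag C n n p q"
    by (simp only: block_diag_adj p(2) q(2))
  ultimately show ?thesis
    using block_diag_closed[OF p(1) q(1)] by (simp add: ab diag_sum_eq projections_def)
qed

lemma diag_sum_zero_left: "a \<in> projections C \<Longrightarrow> diag_sum C (zero_proj C) a = a"
  by (cases a) (auto simp: zero_proj_def diag_sum_def)

lemma diag_sum_zero_right: "a \<in> projections C \<Longrightarrow> diag_sum C a (zero_proj C) = a"
proof -
  assume a: "a \<in> projections C"
  obtain n p where np: "a = (n, p)" by (cases a)
  then show ?thesis
    using matrices_outside[OF projectionsD(1), of n p] a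
    by (auto simp: zero_proj_def diag_sum_def fun_eq_iff)
qed

text \<open>
  The rotation of the index range that exchanges the two blocks is a relabelling.
\<close>

lemma diag_sum_commute:
  assumes "a \<in> projections C" "b \<in> projections C"
  shows "mvn_equiv C (diag_sum C a b) (diag_sum C b a)"
proof -
  obtain n p m q where ab: "a = (n, p)" "b = (m, q)" by (cases a, cases b)
  \<comment> \<open>The position in \<open>a \<oplus> b\<close> of the index \<open>i\<close> of \<open>b \<oplus> a\<close>.\<close>
  define \<sigma> where "\<sigma> i = (if i < m then i + n else i - m)" for i
  have "bij_betw \<sigma> {..<n + m} {..<n + m}"
    by (rule bij_betw_byWitness[where f' = "\<lambda>i. if i < n then i + m else i - n"])
      (auto simp: \<sigma>_def)
  moreover have "block_diag C m m q p i j = block_diag C n n p q (\<sigma> i) (\<sigma> j)"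
    if "i < n + m" "j < n + m" for i j
    using that by (auto simp: block_diag_def \<sigma>_def)
  moreover have "block_diag C m m q p \<in> matrices C (n + m) (n + m)"
    using assms ab block_diag_closed[of q m m p n n] by (auto simp: add.commute dest: projectionsD(1))
  ultimately have "mvn_equiv C (n + m, block_diag C n n p q) (n + m, block_diag C m m q p)"
    using diag_sum_projections[OF assms] ab by (intro mvn_equiv_relabel) (auto simp: diag_sum_eq)
  then show ?thesis
    by (simp add: ab diag_sum_eq add.commute)
qed

lemma diag_sum_cong:
  assumes "mvn_equiv C a a'" "mvn_equiv C b b'"
  shows "mvn_equiv C (diag_sum C a b) (diag_sum C a' b')"
proof -
  obtain n p m q n' p' m' q' where ab: "a = (n, p)" "b = (m, q)" "a' = (n', p')" "b' = (m', q')"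
    by (cases a, cases b, cases a', cases b')
  from assms ab obtain v w where v: "v \<in> matrices C n' n" and w: "w \<in> matrices C m' m"
    and e: "mat_prod C n' (mat_adj C v) v = p" "mat_prod C n v (mat_adj C v) = p'"
      "mat_prod C m' (mat_adj C w) w = q" "mat_prod C m w (mat_adj C w) = q'"
    by (auto simp: mvn_equiv_def)
  have "block_diag C n' n v w \<in> matrices C (n' + m') (n + m)"
    using v w by auto
  moreover have "mat_prod C (n' + m') (mat_adj C (block_diag C n' n v w)) (block_diag C n' n v w)
      = block_diag C n n p q"
    by (simp add: block_diag_adj block_diag_prod[OF mat_adj_closed[OF v] mat_adj_closed[OF w] v w] e)
  moreover have "mat_prod C (n + m) (block_diag C n' n v w) (mat_adj C (block_diag C n' n v w))
      = block_diag C n' n' p' q'"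
    by (simp add: block_diag_adj block_diag_prod[OF v w mat_adj_closed[OF v] mat_adj_closed[OF w]] e)
  ultimately show ?thesis
    by (auto simp: ab diag_sum_eq mvn_equiv_def)
qed

end

section \<open>The Grothendieck relation\<close>

definition mvn_rel :: "('b, 'm) star_alg_scheme \<Rightarrow> ('b mat_elt \<times> 'b mat_elt) set" where
  "mvn_rel B = {(a, b). a \<in> projections B \<and> b \<in> projections B \<and> mvn_equiv B a b}"

text \<open>
  The Murray--von Neumann semigroup of $B$, whose Grothendieck group is \<^term>\<open>K00 B\<close>. Having
  it as a library structure turns the rearrangement of direct sums up to equivalence into
  equational reasoning in a commutative monoid.
\<close>

definition mvn_monoid :: "('b, 'm) star_alg_scheme \<Rightarrow> 'b mat_elt set monoid" where
  "mvn_monoid B = \<lparr>carrier = projections B // mvn_rel B,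
     monoid.mult = (\<lambda>X Y. \<Union>a\<in>X. \<Union>b\<in>Y. mvn_rel B `` {diag_sum B a b}),
     one = mvn_rel B `` {zero_proj B}\<rparr>"

context star_algebra
begin

lemma equiv_mvn_rel: "equiv (projections C) (mvn_rel C)"
proof (rule equivI)
  show "refl_on (projections C) (mvn_rel C)"
    by (auto simp: refl_on_def mvn_rel_def intro: mvn_equiv_refl)
  show "mvn_rel C \<subseteq> projections C \<times> projections C"
    by (auto simp: mvn_rel_def)
  show "sym (mvn_rel C)"
    by (auto simp: sym_def mvn_rel_def intro: mvn_equiv_sym)
  show "trans (mvn_rel C)"
    unfolding trans_def mvn_rel_def by (blast intro: mvn_equiv_trans)
qed

lemma mvn_class_eq_iff:
  "a \<in> projections C \<Longrightarrow> b \<in> projections C \<Longrightarrow> mvn_rel C `` {a} = mvn_rel C `` {b} \<longleftrightarrow> mvn_equiv C a b"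
  using eq_equiv_class_iff[OF equiv_mvn_rel, of a b] by (simp add: mvn_rel_def)

lemma mvn_class_mult:
  assumes "a \<in> projections C" "b \<in> projections C"
  shows "mvn_rel C `` {a} \<otimes>\<^bsub>mvn_monoid C\<^esub> mvn_rel C `` {b} = mvn_rel C `` {diag_sum C a b}"
proof -
  have "congruent2 (mvn_rel C) (mvn_rel C) (\<lambda>a b. mvn_rel C `` {diag_sum C a b})"
  proof (rule congruent2I')
    fix a a' b b' assume "(a, a') \<in> mvn_rel C" "(b, b') \<in> mvn_rel C"
    then show "mvn_rel C `` {diag_sum C a b} = mvn_rel C `` {diag_sum C a' b'}"
      by (subst mvn_class_eq_iff) (auto simp: mvn_rel_def intro: diag_sum_cong)
  qed
  from UN_equiv_class2[OF equiv_mvn_rel equiv_mvn_rel this assms]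
  show ?thesis by (simp add: mvn_monoid_def)
qed

lemma mvn_class_closed: "a \<in> projections C \<Longrightarrow> mvn_rel C `` {a} \<in> carrier (mvn_monoid C)"
  by (simp add: mvn_monoid_def quotientI)

lemma mvn_class_cases:
  assumes "X \<in> carrier (mvn_monoid C)"
  obtains a where "a \<in> projections C" "X = mvn_rel C `` {a}"
  using assms by (auto simp: mvn_monoid_def elim: quotientE)

lemma comm_monoid_mvn_monoid: "comm_monoid (mvn_monoid C)"
proof (rule comm_monoidI)
  show one: "\<one>\<^bsub>mvn_monoid C\<^esub> \<in> carrier (mvn_monoid C)"
    using mvn_class_closed[of "zero_proj C"] by (simp add: mvn_monoid_def)
  fix X Y assume "X \<in> carrier (mvn_monoid C)" "Y \<in> carrier (mvn_monoid C)"
  then obtain a b where ab: "a \<in> projections C" "X = mvn_rel C `` {a}" "b \<in> projections C" "Y = mvn_rel C `` {b}"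
    by (metis mvn_class_cases)
  show "X \<otimes>\<^bsub>mvn_monoid C\<^esub> Y \<in> carrier (mvn_monoid C)"
    using ab by (simp add: mvn_class_mult mvn_class_closed)
  show "X \<otimes>\<^bsub>mvn_monoid C\<^esub> Y = Y \<otimes>\<^bsub>mvn_monoid C\<^esub> X"
    using ab by (simp add: mvn_class_mult mvn_class_eq_iff diag_sum_commute)
  have "\<one>\<^bsub>mvn_monoid C\<^esub> = mvn_rel C `` {zero_proj C}"
    by (simp add: mvn_monoid_def)
  then show "\<one>\<^bsub>mvn_monoid C\<^esub> \<otimes>\<^bsub>mvn_monoid C\<^esub> X = X"
    using ab by (simp add: mvn_class_mult diag_sum_zero_left)
  fix Z assume "Z \<in> carrier (mvn_monoid C)"
  then obtain c where "c \<in> projections C" "Z = mvn_rel C `` {c}"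
    by (metis mvn_class_cases)
  with ab show "X \<otimes>\<^bsub>mvn_monoid C\<^esub> Y \<otimes>\<^bsub>mvn_monoid C\<^esub> Z = X \<otimes>\<^bsub>mvn_monoid C\<^esub> (Y \<otimes>\<^bsub>mvn_monoid C\<^esub> Z)"
    by (simp add: mvn_class_mult diag_sum_assoc)
qed

lemma groth_rel_iff:
  assumes "p \<in> projections C" "q \<in> projections C" "p' \<in> projections C" "q' \<in> projections C"
  shows "((p, q), (p', q')) \<in> groth_rel C \<longleftrightarrow> (\<exists>R\<in>carrier (mvn_monoid C).
    mvn_rel C `` {p} \<otimes>\<^bsub>mvn_monoid C\<^esub> mvn_rel C `` {q'} \<otimes>\<^bsub>mvn_monoid C\<^esub> R
    = mvn_rel C `` {p'} \<otimes>\<^bsub>mvn_monoid C\<^esub> mvn_rel C `` {q} \<otimes>\<^bsub>mvn_monoid C\<^esub> R)" (is "_ \<longleftrightarrow> ?R")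
proof -
  have "((p, q), (p', q')) \<in> groth_rel C \<longleftrightarrow> (\<exists>r\<in>projections C.
      mvn_rel C `` {diag_sum C (diag_sum C p q') r} = mvn_rel C `` {diag_sum C (diag_sum C p' q) r})"
    using assms by (auto simp: groth_rel_def mvn_class_eq_iff)
  also have "\<dots> \<longleftrightarrow> (\<exists>r\<in>projections C.
    mvn_rel C `` {p} \<otimes>\<^bsub>mvn_monoid C\<^esub> mvn_rel C `` {q'} \<otimes>\<^bsub>mvn_monoid C\<^esub> mvn_rel C `` {r}
    = mvn_rel C `` {p'} \<otimes>\<^bsub>mvn_monoid C\<^esub> mvn_rel C `` {q} \<otimes>\<^bsub>mvn_monoid C\<^esub> mvn_rel C `` {r})"
    using assms by (intro bex_cong) (simp_all add: mvn_class_mult)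
  also have "\<dots> \<longleftrightarrow> ?R"
    by (metis mvn_class_cases mvn_class_closed)
  finally show ?thesis .
qed

text \<open>
  Transitivity is the standard argument for formal differences in a commutative monoid without
  cancellation: if $p + q' + r = p' + q + r$ and $p' + q'' + s = p'' + q' + s$, then adding both
  equations gives $p + q'' + t = p'' + q + t$ for $t = p' + q' + r + s$.
\<close>

lemma equiv_groth_rel: "equiv (projections C \<times> projections C) (groth_rel C)"
proof (rule equivI)
  interpret V: comm_monoid "mvn_monoid C" by (rule comm_monoid_mvn_monoid)
  show "groth_rel C \<subseteq> (projections C \<times> projections C) \<times> (projections C \<times> projections C)"
    by (auto simp: groth_rel_def)
  show "refl_on (projections C \<times> projections C) (groth_rel C)"
    by (auto simp: refl_on_def groth_rel_iff intro!: bexI[OF _ V.one_closed])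
  show "sym (groth_rel C)"
    by (auto simp: sym_def groth_rel_def intro: mvn_equiv_sym)
  show "trans (groth_rel C)"
  proof (rule transI)
    fix x y z assume "(x, y) \<in> groth_rel C" "(y, z) \<in> groth_rel C"
    moreover obtain p q p' q' p'' q'' where xyz: "x = (p, q)" "y = (p', q')" "z = (p'', q'')"
      by (cases x, cases y, cases z)
    ultimately have pr: "p \<in> projections C" "q \<in> projections C" "p' \<in> projections C" "q' \<in> projections C"
      "p'' \<in> projections C" "q'' \<in> projections C"
      by (auto simp: groth_rel_def)
    let ?c = "\<lambda>a. mvn_rel C `` {a}"
    note cl = pr[THEN mvn_class_closed]
    from \<open>(x, y) \<in> groth_rel C\<close> pr xyz obtain R where R: "R \<in> carrier (mvn_monoid C)"
      "?c p \<otimes>\<^bsub>mvn_monoid C\<^esub> ?c q' \<otimes>\<^bsub>mvn_monoid C\<^esub> R = ?c p' \<otimes>\<^bsub>mvn_monoid C\<^esub> ?c q \<otimes>\<^bsub>mvn_monoid C\<^esub> R"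
      by (auto simp: groth_rel_iff)
    from \<open>(y, z) \<in> groth_rel C\<close> pr xyz obtain S where S: "S \<in> carrier (mvn_monoid C)"
      "?c p' \<otimes>\<^bsub>mvn_monoid C\<^esub> ?c q'' \<otimes>\<^bsub>mvn_monoid C\<^esub> S = ?c p'' \<otimes>\<^bsub>mvn_monoid C\<^esub> ?c q' \<otimes>\<^bsub>mvn_monoid C\<^esub> S"
      by (auto simp: groth_rel_iff)
    let ?T = "?c p' \<otimes>\<^bsub>mvn_monoid C\<^esub> ?c q' \<otimes>\<^bsub>mvn_monoid C\<^esub> R \<otimes>\<^bsub>mvn_monoid C\<^esub> S"
    have "?c p \<otimes>\<^bsub>mvn_monoid C\<^esub> ?c q'' \<otimes>\<^bsub>mvn_monoid C\<^esub> ?T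
       = (?c p \<otimes>\<^bsub>mvn_monoid C\<^esub> ?c q' \<otimes>\<^bsub>mvn_monoid C\<^esub> R) \<otimes>\<^bsub>mvn_monoid C\<^esub>
         (?c p' \<otimes>\<^bsub>mvn_monoid C\<^esub> ?c q'' \<otimes>\<^bsub>mvn_monoid C\<^esub> S)"
      using cl R(1) S(1) by (simp add: V.m_ac)
    also have "\<dots> = ?c p'' \<otimes>\<^bsub>mvn_monoid C\<^esub> ?c q \<otimes>\<^bsub>mvn_monoid C\<^esub> ?T"
      unfolding R(2) S(2) using cl R(1) S(1) by (simp add: V.m_ac)
    finally show "(x, z) \<in> groth_rel C"
      using pr cl R(1) S(1) unfolding xyz by (auto simp: groth_rel_iff)
  qed
qed

end

section \<open>The class of a projection in $K_0$\<close>

definition mat_map :: "('b \<Rightarrow> 'd) \<Rightarrow> 'b mat_elt \<Rightarrow> 'd mat_elt" where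
  "mat_map h = (\<lambda>(n, p). (n, \<lambda>i j. h (p i j)))"

locale star_homomorphism = B: star_algebra B + D: star_algebra D
  for B :: "('b, 'm) star_alg_scheme" and D :: "('d, 'n) star_alg_scheme" +
  fixes h
  assumes h: "h \<in> star_hom B D"
begin

lemma closed [simp]: "x \<in> carrier B \<Longrightarrow> h x \<in> carrier D"
  and add: "x \<in> carrier B \<Longrightarrow> y \<in> carrier B \<Longrightarrow> h (x \<oplus>\<^bsub>B\<^esub> y) = h x \<oplus>\<^bsub>D\<^esub> h y"
  and mult: "x \<in> carrier B \<Longrightarrow> y \<in> carrier B \<Longrightarrow> h (x \<otimes>\<^bsub>B\<^esub> y) = h x \<otimes>\<^bsub>D\<^esub> h y"
  and smult: "x \<in> carrier B \<Longrightarrow> h (c \<odot>\<^bsub>B\<^esub> x) = c \<odot>\<^bsub>D\<^esub> h x"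
  and adj: "x \<in> carrier B \<Longrightarrow> h (adj B x) = adj D (h x)"
  using h by (auto simp: star_hom_def)

lemma zero [simp]: "h \<zero>\<^bsub>B\<^esub> = \<zero>\<^bsub>D\<^esub>"
  using smult[of "\<zero>\<^bsub>B\<^esub>" 0] B.smult_zero_scalar[of "\<zero>\<^bsub>B\<^esub>"] D.smult_zero_scalar[of "h \<zero>\<^bsub>B\<^esub>"] by simp

lemma map_matrices: "x \<in> matrices B m n \<Longrightarrow> (\<lambda>i j. h (x i j)) \<in> matrices D m n"
  by (auto simp: matrices_def)

lemma map_mat_prod:
  assumes "x \<in> matrices B m k" "y \<in> matrices B k n"
  shows "mat_prod D k (\<lambda>i j. h (x i j)) (\<lambda>i j. h (y i j)) = (\<lambda>i j. h (mat_prod B k x y i j))"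
proof (intro ext)
  fix i j
  note [simp] = assms[THEN B.matrices_entry]
  have "h (mat_prod B k x y i j) = (\<Oplus>\<^bsub>D\<^esub>l\<in>{..<k}. h (x i l \<otimes>\<^bsub>B\<^esub> y l j))"
    unfolding mat_prod_def by (rule finsum_additive_map[OF B.abelian_monoid_C D.abelian_monoid_C]) (auto simp: add)
  then show "mat_prod D k (\<lambda>i j. h (x i j)) (\<lambda>i j. h (y i j)) i j = h (mat_prod B k x y i j)"
    by (simp add: mat_prod_def mult)
qed

lemma map_mat_adj:
  "x \<in> matrices B m n \<Longrightarrow> mat_adj D (\<lambda>i j. h (x i j)) = (\<lambda>i j. h (mat_adj B x i j))"
  by (simp add: mat_adj_def adj)

lemma map_projections: "a \<in> projections B \<Longrightarrow> mat_map h a \<in> projections D"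
proof -
  assume a: "a \<in> projections B"
  obtain n p where np: "a = (n, p)" by (cases a)
  note p = B.projectionsD[OF a[unfolded np]]
  show ?thesis
    using map_matrices[OF p(1)] map_mat_prod[OF p(1) p(1)] map_mat_adj[OF p(1)]
    by (simp only: p(2,3) np mat_map_def projections_def) simp
qed

lemma map_diag_sum: "mat_map h (diag_sum B a b) = diag_sum D (mat_map h a) (mat_map h b)"
  by (cases a; cases b) (auto simp: mat_map_def diag_sum_def fun_eq_iff)

lemma map_mvn_equiv:
  assumes "mvn_equiv B a b"
  shows "mvn_equiv D (mat_map h a) (mat_map h b)"
proof -
  obtain n p m q where ab: "a = (n, p)" "b = (m, q)" by (cases a, cases b)
  with assms obtain v where v: "v \<in> matrices B m n" "mat_prod B m (mat_adj B v) v = p"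
    "mat_prod B n v (mat_adj B v) = q"
    by (auto simp: mvn_equiv_def)
  let ?w = "\<lambda>i j. h (v i j)"
  have "mat_prod D m (mat_adj D ?w) ?w = (\<lambda>i j. h (p i j))"
    using map_mat_prod[OF B.mat_adj_closed[OF v(1)] v(1)] v(2) by (simp only: map_mat_adj[OF v(1)])
  moreover have "mat_prod D n ?w (mat_adj D ?w) = (\<lambda>i j. h (q i j))"
    using map_mat_prod[OF v(1) B.mat_adj_closed[OF v(1)]] v(3) by (simp only: map_mat_adj[OF v(1)])
  ultimately show ?thesis
    using map_matrices[OF v(1)] by (auto simp: ab mat_map_def mvn_equiv_def)
qed

lemma map_groth_rel:
  assumes "((p, q), (p', q')) \<in> groth_rel B"
  shows "((mat_map h p, mat_map h q), (mat_map h p', mat_map h q')) \<in> groth_rel D"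
proof -
  from assms obtain r where pr: "p \<in> projections B" "q \<in> projections B" "p' \<in> projections B"
      "q' \<in> projections B" "r \<in> projections B"
    and r: "mvn_equiv B (diag_sum B (diag_sum B p q') r) (diag_sum B (diag_sum B p' q) r)"
    by (auto simp: groth_rel_def)
  note pr = pr[THEN map_projections]
  show ?thesis
    unfolding groth_rel_def using pr(1-4) map_mvn_equiv[OF r]
    by (auto simp only: map_diag_sum intro!: bexI[OF _ pr(5)])
qed

text \<open>
  \<^const>\<open>K00_map\<close> is a union over all representatives of a class. As all of them have the same
  image class, a single representative determines the value.
\<close>

lemma K00_map_class:
  assumes "p \<in> projections B" "q \<in> projections B"
  shows "K00_map D h (groth_rel B `` {(p, q)}) = groth_rel D `` {(mat_map h p, mat_map h q)}"
proof -
  let ?target = "groth_rel D `` {(mat_map h p, mat_map h q)}"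
  have mem: "(p, q) \<in> groth_rel B `` {(p, q)}"
    by (rule equiv_class_self[OF B.equiv_groth_rel]) (simp add: assms)
  have eq: "(\<lambda>((n, a), (m, b)).
      groth_rel D `` {((n, \<lambda>i j. h (a i j)), (m, \<lambda>i j. h (b i j)))}) x = ?target"
    if "x \<in> groth_rel B `` {(p, q)}" for x
  proof -
    obtain n a m b where x: "x = ((n, a), (m, b))"
      by (metis surj_pair)
    have "((p, q), ((n, a), (m, b))) \<in> groth_rel B"
      using that x by blast
    from equiv_class_eq[OF D.equiv_groth_rel map_groth_rel[OF this]]
    show ?thesis by (simp only: x prod.case mat_map_def)
  qed
  show ?thesis
    unfolding K00_map_def by (intro UN_constant_eq[OF mem] ballI eq)
qed

end

lemma star_algebra_complex_alg: "star_algebra complex_alg"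
proof -
  have ag: "abelian_group complex_alg"
  proof (rule abelian_groupI)
    fix x assume "x \<in> carrier complex_alg"
    then show "\<exists>y\<in>carrier complex_alg. y \<oplus>\<^bsub>complex_alg\<^esub> x = \<zero>\<^bsub>complex_alg\<^esub>"
      by (intro bexI[of _ "- x"]) (auto simp: complex_alg_def)
  qed (simp_all add: complex_alg_def)
  have "comm_monoid complex_alg"
    by (rule comm_monoidI) (simp_all add: complex_alg_def)
  with ag have cr: "cring complex_alg"
    by (rule cringI) (simp add: complex_alg_def distrib_right)
  have "Module.module complex_alg complex_alg"
    by (rule moduleI[OF cr ag]) (simp_all add: complex_alg_def distrib_left distrib_right)
  then show ?thesis
    by (rule star_algebra.intro, unfold_locales) (simp_all add: complex_alg_def distrib_left distrib_right)
qed

context star_algebra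
begin

lemma star_algebra_unitization: "star_algebra (unitization C)"
proof -
  have ring: "cring complex_alg" ..
  have s1: "1 \<odot> x = x" if "x \<in> carrier C" for x
    using smult_one[OF that] by (simp add: complex_alg_def)
  have sm: "(c * d) \<odot> x = c \<odot> (d \<odot> x)" if "x \<in> carrier C" for c d x
    using smult_assoc1[of c d x] that by (simp add: complex_alg_def)
  have sa: "(c + d) \<odot> x = c \<odot> x \<oplus> d \<odot> x" if "x \<in> carrier C" for c d x
    using smult_l_distr[of c d x] that by (simp add: complex_alg_def)
  have "abelian_group (unitization C)"
  proof (rule abelian_groupI)
    fix x assume "x \<in> carrier (unitization C)"
    then show "\<exists>y\<in>carrier (unitization C). y \<oplus>\<^bsub>unitization C\<^esub> x = \<zero>\<^bsub>unitization C\<^esub>"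
      by (intro bexI[of _ "(\<ominus> fst x, - snd x)"]) (auto simp: unitization_def M.l_neg)
  qed (auto simp: unitization_def M.a_ac)
  then have "Module.module complex_alg (unitization C)"
    by (intro moduleI[OF ring])
      (auto simp: unitization_def s1 sm sa smult_r_distr, auto simp: complex_alg_def algebra_simps s1 sm sa)
  then show ?thesis
    unfolding star_algebra_def star_algebra_axioms_def
    by (auto simp: unitization_def s1 sm[symmetric] sa smult_r_distr m_l_distr m_r_distr m_assoc
        smult_m_left smult_m_right adj_add adj_mult adj_smult M.a_ac algebra_simps)
qed

text \<open>
  The canonical character of the unitization sends the projection $(q, 0)$ to the $1 \times 1$ zero
  matrix, which is equivalent to the empty one: the $0 \times 1$ matrix implements the equivalence.
\<close>

lemma K0_class_in_K0:
  assumes "q \<in> carrier C" "adj C q = q" "q \<otimes> q = q"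
  shows "K0_class C q \<in> carrier (K0 C)"
proof -
  let ?U = "unitization C"
  interpret U: star_algebra ?U by (rule star_algebra_unitization)
  interpret S: star_algebra complex_alg by (rule star_algebra_complex_alg)
  interpret snd: star_homomorphism ?U complex_alg snd
    by unfold_locales (auto simp: star_hom_def unitization_def complex_alg_def)
  define P where "P = (1 :: nat, \<lambda>(i :: nat) (j :: nat). if i = 0 \<and> j = 0 then (q, 0 :: complex) else (\<zero>, 0))"
  have U0: "\<zero>\<^bsub>?U\<^esub> = (\<zero>, 0)" by (simp add: unitization_def)
  have q: "(q, 0) \<in> carrier ?U" "adj ?U (q, 0) = (q, 0)" "(q, 0) \<otimes>\<^bsub>?U\<^esub> (q, 0) = (q, 0)"
    using assms by (simp_all add: unitization_def smult_zero_scalar)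
  have P: "P \<in> projections ?U"
    using q U.m_l_null[OF q(1)] U.m_r_null[OF q(1)] U.adj_zero U.M.zero_closed U.m_l_null[OF U.M.zero_closed]
    by (auto simp: P_def projections_def matrices_def mat_adj_def mat_prod_def U0 lessThan_Suc fun_eq_iff)
  have cls: "K0_class C q = groth_rel ?U `` {(P, zero_proj ?U)}"
    by (simp add: K0_class_def P_def)
  have z: "mat_map snd (zero_proj ?U) = zero_proj complex_alg"
    by (simp add: mat_map_def zero_proj_def unitization_def complex_alg_def)
  have "mat_map snd P = (1, \<lambda>i j. \<zero>\<^bsub>complex_alg\<^esub>)"
    by (auto simp: mat_map_def P_def complex_alg_def fun_eq_iff)
  then have "mvn_equiv complex_alg (mat_map snd P) (zero_proj complex_alg)"
    by (auto simp: mvn_equiv_def zero_proj_def matrices_def mat_prod_def mat_adj_def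
        intro!: exI[of _ "\<lambda>i j. \<zero>\<^bsub>complex_alg\<^esub>"])
  then have "((mat_map snd P, zero_proj complex_alg), (zero_proj complex_alg, zero_proj complex_alg))
      \<in> groth_rel complex_alg"
    using snd.map_projections[OF P]
    by (auto simp: groth_rel_def S.diag_sum_zero_right intro!: bexI[of _ "zero_proj complex_alg"])
  then have "K00_map complex_alg snd (K0_class C q) = \<one>\<^bsub>K00 complex_alg\<^esub>"
    using equiv_class_eq[OF S.equiv_groth_rel] P
    by (simp add: cls snd.K00_map_class z K00_def)
  moreover have "K0_class C q \<in> carrier (K00 ?U)"
    using P by (auto simp: cls K00_def intro!: quotientI)
  ultimately show ?thesis
    by (simp add: K0_def kernel_def)
qed

end


section \<open>The cokernel of $B$ and graph automorphisms\<close>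

context wf_digraph
begin

lemma generator_in_Bimage:
  assumes "v \<in> verts G" "in_arcs G v \<noteq> {}"
  shows "frag_of v - (\<Sum>e\<in>in_arcs G v. frag_of (tail G e)) \<in> Bimage G"
  using assms unfolding Bimage_def Bmap_def
  by (intro image_eqI[of _ _ "frag_of v"]) auto

lemma Bimage_zero: "0 \<in> Bimage G"
  unfolding Bimage_def Bmap_def by (intro image_eqI[of _ _ 0]) auto

lemma Bimage_diff: "x \<in> Bimage G \<Longrightarrow> y \<in> Bimage G \<Longrightarrow> x - y \<in> Bimage G"
proof -
  assume "x \<in> Bimage G" "y \<in> Bimage G"
  then obtain c d where "x = Bmap G c" "y = Bmap G d" "Poly_Mapping.keys c \<subseteq> {v \<in> verts G. in_arcs G v \<noteq> {}}"
    "Poly_Mapping.keys d \<subseteq> {v \<in> verts G. in_arcs G v \<noteq> {}}"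
    by (auto simp: Bimage_def)
  then show ?thesis
    using keys_diff[of c d] unfolding Bimage_def
    by (intro image_eqI[of _ _ "c - d"]) (auto simp: Bmap_def frag_extend_diff)
qed

lemma Bimage_uminus: "x \<in> Bimage G \<Longrightarrow> - x \<in> Bimage G"
  using Bimage_diff[OF Bimage_zero] by fastforce

lemma Bimage_add: "x \<in> Bimage G \<Longrightarrow> y \<in> Bimage G \<Longrightarrow> x + y \<in> Bimage G"
  using Bimage_diff[OF _ Bimage_uminus, of x y] by simp

lemma Bimage_induct [consumes 1, case_names zero generator diff]:
  assumes "x \<in> Bimage G" "P 0"
    and "\<And>v. v \<in> verts G \<Longrightarrow> in_arcs G v \<noteq> {} \<Longrightarrow> P (frag_of v - (\<Sum>e\<in>in_arcs G v. frag_of (tail G e)))"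
    and "\<And>x y. x \<in> Bimage G \<Longrightarrow> y \<in> Bimage G \<Longrightarrow> P x \<Longrightarrow> P y \<Longrightarrow> P (x - y)"
  shows "P x"
proof -
  obtain c where c: "x = Bmap G c" "Poly_Mapping.keys c \<subseteq> {v \<in> verts G. in_arcs G v \<noteq> {}}"
    using assms(1) by (auto simp: Bimage_def)
  from c(2) have "Bmap G c \<in> Bimage G \<and> P (Bmap G c)"
  proof (induction c rule: frag_induction)
    case (diff a b)
    then show ?case using assms(4) Bimage_diff by (auto simp: Bmap_def frag_extend_diff)
  qed (use assms(2,3) Bimage_zero generator_in_Bimage in \<open>auto simp: Bmap_def\<close>)
  then show ?thesis by (simp add: c)
qed

lemma Bimage_subset: "x \<in> Bimage G \<Longrightarrow> Poly_Mapping.keys x \<subseteq> verts G"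
proof (induction x rule: Bimage_induct)
  case (generator v)
  have "(\<Sum>e\<in>in_arcs G v. frag_of (tail G e)) \<in> carrier (free_Abelian_group (verts G))"
    by (rule sum_closed_free_Abelian_group) auto
  then show ?case
    using generator keys_diff[of "frag_of v" "\<Sum>e\<in>in_arcs G v. frag_of (tail G e)"] by auto
next
  case (diff x y)
  then show ?case using keys_diff[of x y] by blast
qed simp

lemma normal_Bimage: "Bimage G \<lhd> free_Abelian_group (verts G)"
proof -
  interpret F: comm_group "free_Abelian_group (verts G)" by (rule abelian_free_Abelian_group)
  have "subgroup (Bimage G) (free_Abelian_group (verts G))"
    using Bimage_zero by (intro F.subgroupI) (auto simp: Bimage_subset Bimage_uminus Bimage_add)
  then show ?thesis by (simp add: F.normal_iff_subgroup)
qed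

lemma Bimage_coset: "Bimage G #>\<^bsub>free_Abelian_group (verts G)\<^esub> x = (\<lambda>b. b + x) ` Bimage G"
  by (auto simp: r_coset_def)

lemma Bimage_coset_eq_iff:
  "Bimage G #>\<^bsub>free_Abelian_group (verts G)\<^esub> x = Bimage G #>\<^bsub>free_Abelian_group (verts G)\<^esub> y
    \<longleftrightarrow> x - y \<in> Bimage G"
proof
  assume "Bimage G #>\<^bsub>free_Abelian_group (verts G)\<^esub> x = Bimage G #>\<^bsub>free_Abelian_group (verts G)\<^esub> y"
  moreover have "x \<in> (\<lambda>b. b + x) ` Bimage G"
    using Bimage_zero by (intro image_eqI[of _ _ 0]) auto
  ultimately show "x - y \<in> Bimage G" by (auto simp: Bimage_coset)
next
  have sub: "(\<lambda>b. b + x) ` Bimage G \<subseteq> (\<lambda>b. b + y) ` Bimage G" if "x - y \<in> Bimage G" for x y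
    using that Bimage_add by (auto simp: image_iff intro!: bexI[of _ "b + (x - y)" for b])
  assume "x - y \<in> Bimage G"
  then show "Bimage G #>\<^bsub>free_Abelian_group (verts G)\<^esub> x = Bimage G #>\<^bsub>free_Abelian_group (verts G)\<^esub> y"
    using sub[of x y] sub[of y x] Bimage_uminus[of "x - y"] by (auto simp: Bimage_coset)
qed

text \<open>
  A graph automorphism is only a map of vertices. Its effect on the edges into $v$ is assembled from a
  choice of bijections between the sets of parallel edges, one for each source vertex.
\<close>

lemma graph_automorphism_in_arcs:
  assumes "graph_automorphism G \<psi>" "v \<in> verts G"
  obtains f where "bij_betw f (in_arcs G v) (in_arcs G (\<psi> v))"
    and "\<And>e. e \<in> in_arcs G v \<Longrightarrow> tail G (f e) = \<psi> (tail G e)"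
proof -
  have \<psi>: "bij_betw \<psi> (verts G) (verts G)"
    using assms(1) by (simp add: graph_automorphism_def)
  have "\<forall>u\<in>verts G. \<exists>g. bij_betw g (arcs_from_to G u v) (arcs_from_to G (\<psi> u) (\<psi> v))"
    using assms by (auto simp: graph_automorphism_def eqpoll_def)
  then obtain g where g: "bij_betw (g u) (arcs_from_to G u v) (arcs_from_to G (\<psi> u) (\<psi> v))"
    if "u \<in> verts G" for u
    by metis
  \<comment> \<open>Edges with different sources do not interfere, as \<open>\<psi>\<close> is injective on vertices.\<close>
  define f where "f e = g (tail G e) e" for e
  have mem: "e \<in> arcs_from_to G (tail G e) v" "tail G e \<in> verts G" if "e \<in> in_arcs G v" for e
    using that by (auto simp: arcs_from_to_def)
  have f: "f e \<in> arcs_from_to G (\<psi> (tail G e)) (\<psi> v)" if "e \<in> in_arcs G v" for e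
    using g[OF mem(2)[OF that]] mem(1)[OF that] by (auto simp: bij_betw_def f_def)
  then have tl: "tail G (f e) = \<psi> (tail G e)" if "e \<in> in_arcs G v" for e
    using that by (auto simp: arcs_from_to_def)
  have "inj_on f (in_arcs G v)"
  proof (rule inj_onI)
    fix d e assume d: "d \<in> in_arcs G v" and e: "e \<in> in_arcs G v" and "f d = f e"
    then have "\<psi> (tail G d) = \<psi> (tail G e)" by (metis tl)
    then have "tail G d = tail G e"
      using \<psi> mem(2)[OF d] mem(2)[OF e] by (auto simp: bij_betw_def dest: inj_onD)
    with \<open>f d = f e\<close> g[OF mem(2)[OF e]] mem(1)[OF d] mem(1)[OF e] show "d = e"
      by (auto simp: f_def bij_betw_def dest: inj_onD)
  qed
  moreover have "f ` in_arcs G v = in_arcs G (\<psi> v)"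
  proof (intro subset_antisym subsetI)
    fix e assume "e \<in> f ` in_arcs G v"
    then show "e \<in> in_arcs G (\<psi> v)" using f by (fastforce simp: arcs_from_to_def)
  next
    fix e assume e: "e \<in> in_arcs G (\<psi> v)"
    then obtain u where u: "u \<in> verts G" "tail G e = \<psi> u"
      using \<psi> by (metis bij_betw_imp_surj_on imageE in_in_arcs_conv tail_in_verts)
    then have "e \<in> g u ` arcs_from_to G u v"
      using e g[OF u(1)] by (auto simp: bij_betw_def arcs_from_to_def)
    then obtain d where "d \<in> arcs_from_to G u v" "e = g u d" by blast
    then show "e \<in> f ` in_arcs G v"
      by (intro image_eqI[of _ _ d]) (auto simp: f_def arcs_from_to_def)
  qed
  ultimately show ?thesis
    using tl by (intro that) (auto simp: bij_betw_def)
qed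

text \<open>
  The linear extension of $\psi$ maps the relation at $u$ to the relation at $\psi(u)$. Since $\psi$
  permutes the vertices with incoming edges, it maps the image of $B$ onto itself, not just into
  itself; equality is what the image of a coset requires.
\<close>

lemma cokerB_map_class:
  assumes "graph_automorphism G \<psi>"
  shows "cokerB_map \<psi> (cokerB_class G v) = cokerB_class G (\<psi> v)"
proof -
  let ?L = "frag_extend (frag_of \<circ> \<psi>)"
  have \<psi>: "bij_betw \<psi> (verts G) (verts G)"
    using assms by (simp add: graph_automorphism_def)
  have gen: "?L (frag_of u - (\<Sum>e\<in>in_arcs G u. frag_of (tail G e)))
      = frag_of (\<psi> u) - (\<Sum>e\<in>in_arcs G (\<psi> u). frag_of (tail G e))"
    and ne: "in_arcs G (\<psi> u) = {} \<longleftrightarrow> in_arcs G u = {}" if "u \<in> verts G" for u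
  proof -
    obtain f where f: "bij_betw f (in_arcs G u) (in_arcs G (\<psi> u))"
      "\<And>e. e \<in> in_arcs G u \<Longrightarrow> tail G (f e) = \<psi> (tail G e)"
      using graph_automorphism_in_arcs[OF assms \<open>u \<in> verts G\<close>] by blast
    have "?L (\<Sum>e\<in>in_arcs G u. frag_of (tail G e)) = (\<Sum>e\<in>in_arcs G u. frag_of (tail G (f e)))"
      using f(2) by (cases "finite (in_arcs G u)") (auto simp: frag_extend_sum intro!: sum.cong)
    also have "\<dots> = (\<Sum>e\<in>in_arcs G (\<psi> u). frag_of (tail G e))"
      by (rule sum.reindex_bij_betw[OF f(1)])
    finally show "?L (frag_of u - (\<Sum>e\<in>in_arcs G u. frag_of (tail G e)))
      = frag_of (\<psi> u) - (\<Sum>e\<in>in_arcs G (\<psi> u). frag_of (tail G e))"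
      by (simp add: frag_extend_diff)
    show "in_arcs G (\<psi> u) = {} \<longleftrightarrow> in_arcs G u = {}"
      using f(1) bij_betw_empty1 bij_betw_empty2 by metis
  qed
  have sub: "?L x \<in> Bimage G" if "x \<in> Bimage G" for x
    using that
  proof (induction x rule: Bimage_induct)
    case (generator u)
    then have "\<psi> u \<in> verts G" using \<psi> by (auto simp: bij_betw_def)
    then show ?case
      using generator by (subst gen) (auto simp only: ne intro!: generator_in_Bimage)
  qed (auto simp: Bimage_zero frag_extend_diff Bimage_diff)
  have sup: "x \<in> ?L ` Bimage G" if "x \<in> Bimage G" for x
    using that
  proof (induction x rule: Bimage_induct)
    case zero
    show ?case using Bimage_zero by (intro image_eqI[of _ _ 0]) auto
  next
    case (generator w)
    then obtain u where "u \<in> verts G" "w = \<psi> u" using \<psi> by (auto simp: bij_betw_def)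
    then have "?L (frag_of u - (\<Sum>e\<in>in_arcs G u. frag_of (tail G e))) \<in> ?L ` Bimage G"
      using generator ne[of u] by (intro imageI generator_in_Bimage) auto
    then show ?case
      by (simp only: gen[OF \<open>u \<in> verts G\<close>] \<open>w = \<psi> u\<close>)
  next
    case (diff x y)
    then obtain x' y' where "x' \<in> Bimage G" "y' \<in> Bimage G" "x = ?L x'" "y = ?L y'" by blast
    then show ?case
      by (intro image_eqI[of _ _ "x' - y'"]) (simp_all add: frag_extend_diff Bimage_diff o_def)
  qed
  have "?L ` Bimage G = Bimage G"
    using sub sup by auto
  then have "(\<lambda>b. b + frag_of (\<psi> v)) ` ?L ` Bimage G = (\<lambda>b. b + frag_of (\<psi> v)) ` Bimage G"
    by simp
  then show ?thesis
    by (simp add: cokerB_map_def cokerB_class_def Bimage_coset image_image frag_extend_add)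
qed

end

section \<open>The cokernel for the graph $\Gamma(A)$\<close>

text \<open>
  The element \<open>a\<close> with $[g] = [v_a]$ in the cokernel, for each vertex $g$.
\<close>

fun vertex_value :: "('a, 'm) monoid_scheme \<Rightarrow> 'a gvertex \<Rightarrow> 'a" where
  "vertex_value A (V a) = a"
| "vertex_value A (U a) = inv\<^bsub>A\<^esub> a"
| "vertex_value A (W1 a b) = a"
| "vertex_value A (W2 a b) = b"
| "vertex_value A (UU a b) = \<one>\<^bsub>A\<^esub>"
| "vertex_value A (UUn n a b) = \<one>\<^bsub>A\<^esub>"

lemma verts_Gamma_iff [simp]:
  "V a \<in> verts (Gamma A) \<longleftrightarrow> a \<in> carrier A"
  "U a \<in> verts (Gamma A) \<longleftrightarrow> a \<in> carrier A"
  "W1 a b \<in> verts (Gamma A) \<longleftrightarrow> a \<in> carrier A \<and> b \<in> carrier A"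
  "W2 a b \<in> verts (Gamma A) \<longleftrightarrow> a \<in> carrier A \<and> b \<in> carrier A"
  "UU a b \<in> verts (Gamma A) \<longleftrightarrow> a \<in> carrier A \<and> b \<in> carrier A"
  "UUn n a b \<in> verts (Gamma A) \<longleftrightarrow> n \<ge> 1 \<and> a \<in> carrier A \<and> b \<in> carrier A"
  by (auto simp: Gamma_def)

lemma in_arcs_Gamma:
  shows "in_arcs (Gamma A) (V c) = {}"
    and "c \<in> carrier A \<Longrightarrow> in_arcs (Gamma A) (U c) = {VtoU c, Uloop1 c, Uloop2 c}"
    and "a \<in> carrier A \<Longrightarrow> b \<in> carrier A \<Longrightarrow> in_arcs (Gamma A) (W1 a b) = {VtoW1 a b}"
    and "a \<in> carrier A \<Longrightarrow> b \<in> carrier A \<Longrightarrow> in_arcs (Gamma A) (W2 a b) = {VtoW2 a b}"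
    and "a \<in> carrier A \<Longrightarrow> b \<in> carrier A \<Longrightarrow> in_arcs (Gamma A) (UU a b) = {W1toUU a b, W2toUU a b, UtoUU a b}"
    and "a \<in> carrier A \<Longrightarrow> b \<in> carrier A \<Longrightarrow> n \<ge> 1 \<Longrightarrow> in_arcs (Gamma A) (UUn n a b) = {UUchain n a b, UUloop n a b}"
  by (auto simp: Gamma_def)

lemma tail_Gamma: "tail (Gamma A) = Gamma_source A"
  by (simp add: Gamma_def)

context comm_group
begin

text \<open>
  The relations between vertices in the cokernel. Because of its loop, the vertex $u^n_{ab}$
  cancels from its own relation, which therefore says that its predecessor vanishes. So the relation
  at $u^1_{ab}$ kills $u_{ab}$ and the one at $u^{n+1}_{ab}$ kills $u^n_{ab}$. Likewise the two loops
  at $u_c$ turn its relation into $v_c + u_c = 0$. The last relation is the one at $u_{ab}$ after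
  substituting the others.
\<close>

lemma Bimage_Gamma_relations:
  assumes "a \<in> carrier G" "b \<in> carrier G"
  shows "frag_of (V a) + frag_of (U a) \<in> Bimage (Gamma G)"
    and "frag_of (W1 a b) - frag_of (V a) \<in> Bimage (Gamma G)"
    and "frag_of (W2 a b) - frag_of (V b) \<in> Bimage (Gamma G)"
    and "frag_of (UU a b) \<in> Bimage (Gamma G)"
    and "n \<ge> 1 \<Longrightarrow> frag_of (UUn n a b) \<in> Bimage (Gamma G)"
    and "frag_of (V a) + frag_of (V b) - frag_of (V (a \<otimes> b)) \<in> Bimage (Gamma G)"
proof -
  interpret Gam: wf_digraph "Gamma G" by (rule wf_digraph_Gamma) (rule comm_group_axioms)
  have verts: "U c \<in> verts (Gamma G)" if "c \<in> carrier G" for c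
    using that by auto
  have verts2: "W1 a b \<in> verts (Gamma G)" "W2 a b \<in> verts (Gamma G)" "UU a b \<in> verts (Gamma G)"
    "n \<ge> 1 \<Longrightarrow> UUn n a b \<in> verts (Gamma G)" for n
    using assms by auto
  have U: "frag_of (V c) + frag_of (U c) \<in> Bimage (Gamma G)" if "c \<in> carrier G" for c
    using Gam.Bimage_uminus[OF Gam.generator_in_Bimage[OF verts[OF that]]] that
    by (simp add: in_arcs_Gamma tail_Gamma algebra_simps)
  then show "frag_of (V a) + frag_of (U a) \<in> Bimage (Gamma G)" using assms by simp
  show W1: "frag_of (W1 a b) - frag_of (V a) \<in> Bimage (Gamma G)"
    and W2: "frag_of (W2 a b) - frag_of (V b) \<in> Bimage (Gamma G)"
    using Gam.generator_in_Bimage[OF verts2(1)] Gam.generator_in_Bimage[OF verts2(2)] assms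
    by (simp_all add: in_arcs_Gamma tail_Gamma)
  show UU: "frag_of (UU a b) \<in> Bimage (Gamma G)"
    using Gam.Bimage_uminus[OF Gam.generator_in_Bimage[OF verts2(4)[of 1]]] assms
    by (simp add: in_arcs_Gamma tail_Gamma)
  show "frag_of (UUn n a b) \<in> Bimage (Gamma G)" if "n \<ge> 1"
    using Gam.Bimage_uminus[OF Gam.generator_in_Bimage[OF verts2(4)[of "Suc n"]]] assms that
    by (simp add: in_arcs_Gamma tail_Gamma)
  have B: "frag_of (UU a b) - (frag_of (W1 a b) + frag_of (W2 a b) + frag_of (U (a \<otimes> b))) \<in> Bimage (Gamma G)"
    using Gam.generator_in_Bimage[OF verts2(3)] assms
    by (simp add: in_arcs_Gamma tail_Gamma algebra_simps)
  have "frag_of (V a) + frag_of (V b) - frag_of (V (a \<otimes> b))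
    = frag_of (UU a b)
      - (frag_of (UU a b) - (frag_of (W1 a b) + frag_of (W2 a b) + frag_of (U (a \<otimes> b))))
      - (frag_of (W1 a b) - frag_of (V a)) - (frag_of (W2 a b) - frag_of (V b))
      - (frag_of (V (a \<otimes> b)) + frag_of (U (a \<otimes> b)))"
    by (simp add: algebra_simps)
  also have "\<dots> \<in> Bimage (Gamma G)"
    using assms by (intro Gam.Bimage_diff UU B W1 W2 U) auto
  finally show "frag_of (V a) + frag_of (V b) - frag_of (V (a \<otimes> b)) \<in> Bimage (Gamma G)" .
qed

text \<open>
  $v_0 + v_0 - v_0$ is one of the relations.
\<close>

lemma frag_of_V_one_in_Bimage: "frag_of (V \<one>) \<in> Bimage (Gamma G)"
  using Bimage_Gamma_relations(6)[of \<one> \<one>] by simp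

lemma vertex_congruent_V:
  assumes "g \<in> verts (Gamma G)"
  shows "vertex_value G g \<in> carrier G" "frag_of g - frag_of (V (vertex_value G g)) \<in> Bimage (Gamma G)"
proof -
  interpret Gam: wf_digraph "Gamma G" by (rule wf_digraph_Gamma) (rule comm_group_axioms)
  note R = Bimage_Gamma_relations frag_of_V_one_in_Bimage
  show "vertex_value G g \<in> carrier G"
    using assms by (cases g) auto
  have U: "frag_of (U a) - frag_of (V (inv a)) \<in> Bimage (Gamma G)" if "a \<in> carrier G" for a
  proof -
    have "frag_of (V a) + frag_of (V (inv a)) - frag_of (V \<one>) \<in> Bimage (Gamma G)"
      using R(6)[of a "inv a"] that by simp
    from Gam.Bimage_diff[OF Gam.Bimage_diff[OF R(1)[OF that that] this] R(7)]
    show ?thesis by (simp add: algebra_simps)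
  qed
  show "frag_of g - frag_of (V (vertex_value G g)) \<in> Bimage (Gamma G)"
    using assms by (cases g) (auto simp: Gam.Bimage_zero U R intro!: Gam.Bimage_diff)
qed

text \<open>
  Differences of the elements $[v_a]$ are again of this form, so these elements, which contain the
  classes of all vertices, exhaust the cokernel.
\<close>

lemma free_element_congruent_V:
  assumes "Poly_Mapping.keys x \<subseteq> verts (Gamma G)"
  shows "\<exists>a\<in>carrier G. x - frag_of (V a) \<in> Bimage (Gamma G)"
  using assms
proof (induction x rule: frag_induction)
  interpret Gam: wf_digraph "Gamma G" by (rule wf_digraph_Gamma) (rule comm_group_axioms)
  case zero
  then show ?case
    using Gam.Bimage_uminus[OF frag_of_V_one_in_Bimage] by auto
next
  case (one g)
  then show ?case using vertex_congruent_V by blast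
next
  interpret Gam: wf_digraph "Gamma G" by (rule wf_digraph_Gamma) (rule comm_group_axioms)
  case (diff x y)
  then obtain a b where ab: "a \<in> carrier G" "b \<in> carrier G"
    and x: "x - frag_of (V a) \<in> Bimage (Gamma G)" and y: "y - frag_of (V b) \<in> Bimage (Gamma G)"
    by blast
  have "(a \<otimes> inv b) \<otimes> b = a"
    using ab by (simp add: m_assoc)
  then have "frag_of (V (a \<otimes> inv b)) + frag_of (V b) - frag_of (V a) \<in> Bimage (Gamma G)"
    using Bimage_Gamma_relations(6)[of "a \<otimes> inv b" b] ab by simp
  from Gam.Bimage_diff[OF Gam.Bimage_diff[OF x y] this]
  have "x - y - frag_of (V (a \<otimes> inv b)) \<in> Bimage (Gamma G)"
    by (simp add: algebra_simps)
  then show ?case using ab by blast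
qed

text \<open>
  \<^const>\<open>vertex_value\<close> extends to a homomorphism \<open>h\<close> on $\mathbb{Z}V$. It satisfies every defining
  relation, so it separates $v_a$ and $v_b$ modulo the image of $B$ whenever $a \neq b$.
\<close>

lemma Bimage_Gamma_V_inj:
  assumes "a \<in> carrier G" "b \<in> carrier G" "frag_of (V a) - frag_of (V b) \<in> Bimage (Gamma G)"
  shows "a = b"
proof -
  interpret Gam: wf_digraph "Gamma G" by (rule wf_digraph_Gamma) (rule comm_group_axioms)
  let ?F = "free_Abelian_group (verts (Gamma G))"
  obtain h where h: "h \<in> hom ?F G" "\<And>g. g \<in> verts (Gamma G) \<Longrightarrow> h (frag_of g) = vertex_value G g"
    using free_Abelian_group_universal[of "vertex_value G" "verts (Gamma G)"] vertex_congruent_V(1) by blast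
  interpret h: group_hom ?F G h
    by (rule group_hom.intro) (use h in \<open>auto simp: group_hom_axioms_def\<close>)
  have add: "h (x + y) = h x \<otimes> h y"
    if "Poly_Mapping.keys x \<subseteq> verts (Gamma G)" "Poly_Mapping.keys y \<subseteq> verts (Gamma G)" for x y
    using h.hom_mult[of x y] that by simp
  have h_diff: "h (x - y) = h x \<otimes> inv (h y)"
    if "Poly_Mapping.keys x \<subseteq> verts (Gamma G)" "Poly_Mapping.keys y \<subseteq> verts (Gamma G)" for x y
    using h.hom_mult[of x "- y"] h.hom_inv[of y] that by simp
  have uminus: "h (- x) = inv (h x)" if "Poly_Mapping.keys x \<subseteq> verts (Gamma G)" for x
    using h.hom_inv[of x] that by simp
  have keys_add: "Poly_Mapping.keys (x + y) \<subseteq> verts (Gamma G)"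
    if "Poly_Mapping.keys x \<subseteq> verts (Gamma G)" "Poly_Mapping.keys y \<subseteq> verts (Gamma G)"
    for x y :: "'a gvertex \<Rightarrow>\<^sub>0 int"
    using that keys_add[of x y] by blast
  have "h x = \<one>" if "x \<in> Bimage (Gamma G)" for x
    using that
  proof (induction x rule: Gam.Bimage_induct)
    case zero
    show ?case using h.hom_one by simp
  next
    case (generator v)
    have verts: "V c \<in> verts (Gamma G)" "U c \<in> verts (Gamma G)" if "c \<in> carrier G" for c
      using that by auto
    have verts2: "W1 c d \<in> verts (Gamma G)" "W2 c d \<in> verts (Gamma G)" "UU c d \<in> verts (Gamma G)"
      "n \<ge> 1 \<Longrightarrow> UUn n c d \<in> verts (Gamma G)" if "c \<in> carrier G" "d \<in> carrier G" for c d n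
      using that by auto
    note [simp] = verts verts2 h(2) add h_diff uminus in_arcs_Gamma tail_Gamma keys_add
    show ?case
    proof (cases v)
      case (V c)
      then show ?thesis using generator by simp
    next
      case (U c)
      then have "c \<in> carrier G" using generator by auto
      then show ?thesis using U by (simp add: m_ac inv_mult)
    next
      case (W1 c d)
      then have "c \<in> carrier G" "d \<in> carrier G" using generator by auto
      then show ?thesis using W1 by simp
    next
      case (W2 c d)
      then have "c \<in> carrier G" "d \<in> carrier G" using generator by auto
      then show ?thesis using W2 by simp
    next
      case (UU c d)
      then have "c \<in> carrier G" "d \<in> carrier G" using generator by auto
      then show ?thesis using UU by (simp add: m_assoc[symmetric])
    next
      case (UUn n c d)
      then have "c \<in> carrier G" "d \<in> carrier G" "n \<ge> 1" using generator by auto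
      then show ?thesis using UUn by simp
    qed
  next
    case (diff x y)
    then show ?case by (simp add: h_diff Gam.Bimage_subset)
  qed
  from this[OF assms(3)] have "a \<otimes> inv b = \<one>"
    using assms h_diff[of "frag_of (V a)" "frag_of (V b)"] h(2) by auto
  then show ?thesis
    using assms by (metis inv_equality inv_inv inv_closed)
qed

lemma cokerB_Gamma_iso: "(\<lambda>a. cokerB_class (Gamma G) (V a)) \<in> iso G (cokerB (Gamma G))"
proof -
  interpret Gam: wf_digraph "Gamma G" by (rule wf_digraph_Gamma) (rule comm_group_axioms)
  interpret N: normal "Bimage (Gamma G)" "free_Abelian_group (verts (Gamma G))"
    by (rule Gam.normal_Bimage)
  let ?c = "\<lambda>a. cokerB_class (Gamma G) (V a)"
  have V: "V a \<in> verts (Gamma G)" if "a \<in> carrier G" for a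
    using that by auto
  have carrier: "carrier (cokerB (Gamma G))
      = (\<lambda>x. Bimage (Gamma G) #>\<^bsub>free_Abelian_group (verts (Gamma G))\<^esub> x) ` {x. Poly_Mapping.keys x \<subseteq> verts (Gamma G)}"
    by (auto simp: cokerB_def carrier_FactGroup)
  have closed: "?c a \<in> carrier (cokerB (Gamma G))" if "a \<in> carrier G" for a
    using V[OF that] by (auto simp: carrier cokerB_class_def)
  have "?c \<in> hom G (cokerB (Gamma G))"
  proof (rule homI)
    fix a b assume ab: "a \<in> carrier G" "b \<in> carrier G"
    have "?c a \<otimes>\<^bsub>cokerB (Gamma G)\<^esub> ?c b
        = Bimage (Gamma G) #>\<^bsub>free_Abelian_group (verts (Gamma G))\<^esub> (frag_of (V a) + frag_of (V b))"
      using N.rcos_sum[of "frag_of (V a)" "frag_of (V b)"] V ab by (simp add: cokerB_def cokerB_class_def FactGroup_def)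
    also have "\<dots> = ?c (a \<otimes> b)"
      unfolding cokerB_class_def Gam.Bimage_coset_eq_iff using ab by (rule Bimage_Gamma_relations(6))
    finally show "?c (a \<otimes> b) = ?c a \<otimes>\<^bsub>cokerB (Gamma G)\<^esub> ?c b" by simp
  qed (rule closed)
  moreover have "inj_on ?c (carrier G)"
    by (rule inj_onI) (auto simp: cokerB_class_def Gam.Bimage_coset_eq_iff intro: Bimage_Gamma_V_inj)
  moreover have "carrier (cokerB (Gamma G)) \<subseteq> ?c ` carrier G"
    using free_element_congruent_V by (fastforce simp: carrier cokerB_class_def Gam.Bimage_coset_eq_iff image_iff)
  ultimately show ?thesis
    using closed by (auto simp: iso_def bij_betw_def)
qed

end

section \<open>The automorphism of $K_0$ induced by $\Gamma(\phi)$\<close>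

theorem lemma3p2:
  fixes A :: "('a, 'm) monoid_scheme"
    and \<phi> :: "'a \<Rightarrow> 'a"
    and C :: "'c cstar_alg"
    and p :: "'a gvertex \<Rightarrow> 'c"
    and S :: "'a gedge \<Rightarrow> 'c"
    and \<kappa> :: "('c \<times> complex) K00_elt \<Rightarrow> ('a gvertex \<Rightarrow>\<^sub>0 int) set"
  assumes "comm_group A"
    and "countable (carrier A)"
    and "\<phi> \<in> iso A A"
    and "graph_cstar_algebra (Gamma A) C p S"
    and "K0_cokerB_iso (Gamma A) C p \<kappa>"
  shows "(\<exists>\<theta>. K0_Gamma_iso A C p \<theta>) \<and>
    (\<forall>\<theta>. K0_Gamma_iso A C p \<theta> \<longrightarrow>
      (\<forall>x\<in>carrier (K0 C). \<theta> (K0_underline C \<kappa> (Gamma_map \<phi>) x) = \<phi> (\<theta> x)))"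
proof -
  interpret A: comm_group A by fact
  interpret Gam: wf_digraph "Gamma A" by (rule wf_digraph_Gamma) fact
  have \<phi>: "\<phi> a \<in> carrier A" if "a \<in> carrier A" for a
    using assms(3) that by (auto simp: iso_def hom_def)
  have \<kappa>: "\<kappa> \<in> iso (K0 C) (cokerB (Gamma A))"
    and \<kappa>V: "\<kappa> (K0_class C (p (V a))) = cokerB_class (Gamma A) (V a)" if "a \<in> carrier A" for a
    using assms(5) that by (auto simp: K0_cokerB_iso_def)
  then have \<kappa>_bij: "bij_betw \<kappa> (carrier (K0 C)) (carrier (cokerB (Gamma A)))"
    using A.one_closed by (auto simp: iso_def)
  let ?c = "\<lambda>a. cokerB_class (Gamma A) (V a)"
  have c: "?c \<in> iso A (cokerB (Gamma A))" by (rule A.cokerB_Gamma_iso)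
  interpret C: cstar_algebra C
    using assms(4) by (simp add: graph_cstar_algebra_def)
  have K0V: "K0_class C (p (V a)) \<in> carrier (K0 C)" if "a \<in> carrier A" for a
    using assms(4) that
    by (intro C.K0_class_in_K0) (auto simp: graph_cstar_algebra_def graph_family_def)
  let ?\<theta> = "inv_into (carrier A) ?c \<circ> \<kappa>"
  have "?\<theta> \<in> iso (K0 C) A"
    using iso_set_trans[OF \<kappa>[OF A.one_closed] A.iso_set_sym[OF c]] .
  moreover have "?\<theta> (K0_class C (p (V a))) = a" if "a \<in> carrier A" for a
    using c that by (auto simp: \<kappa>V iso_def bij_betw_def inv_into_f_f[of ?c])
  ultimately have "\<exists>\<theta>. K0_Gamma_iso A C p \<theta>"
    by (auto simp: K0_Gamma_iso_def)
  moreover have "\<theta> (K0_underline C \<kappa> (Gamma_map \<phi>) x) = \<phi> (\<theta> x)"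
    if \<theta>: "K0_Gamma_iso A C p \<theta>" and x: "x \<in> carrier (K0 C)" for \<theta> x
  proof -
    have \<theta>V: "\<theta> (K0_class C (p (V a))) = a" if "a \<in> carrier A" for a
      using \<theta> that by (simp add: K0_Gamma_iso_def)
    have "\<kappa> x \<in> ?c ` carrier A"
      using c \<kappa>_bij x by (auto simp: iso_def bij_betw_def)
    then obtain a where a: "a \<in> carrier A" "\<kappa> x = ?c a" by blast
    then have xa: "x = K0_class C (p (V a))"
      using inj_onD[OF bij_betw_imp_inj_on[OF \<kappa>_bij], of x "K0_class C (p (V a))"] x K0V \<kappa>V by simp
    have "cokerB_map (Gamma_map \<phi>) (\<kappa> x) = \<kappa> (K0_class C (p (V (\<phi> a))))"
      using Gam.cokerB_map_class[OF graph_automorphism_Gamma_map[OF assms(1,3)], of "V a"] a \<phi>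
      by (simp add: \<kappa>V)
    then have "K0_underline C \<kappa> (Gamma_map \<phi>) x = K0_class C (p (V (\<phi> a)))"
      using \<kappa>_bij K0V[OF \<phi>[OF a(1)]] by (simp add: K0_underline_def bij_betw_def inv_into_f_f)
    then show ?thesis
      using xa a(1) \<phi> \<theta>V by simp
  qed
  ultimately show ?thesis by blast
qed

end
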